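(* Let $\varphi(x,y)$ be a first-order formula in the language of graphs and let $\mathcal C$ be a graph class of bounded merge-width. Then the class $\{\varphi(G):G\in\mathcal C\}$ has bounded merge-width.
   Context: Graphs are finite, simple and undirected: $G=(V,E(G))$ with $E(G)\subseteq\binom V2$. For a graph $G$ and a first-order formula $\varphi(x,y)$ over the signature with one binary relation symbol interpreted as adjacency, $\varphi(G)$ is the graph with vertex set $V(G)$ and edges $\{u,v\}\in\binom{V(G)}2$ such that $G\models\varphi(u,v)\lor\varphi(v,u)$. Merge-width. A construction sequence on $V$ is a sequence of steps maintaining a partition $\mathcal P$ of $V$ and a partition of $\binom V2$ into edges $E$, non-edges $N$, and unresolved pairs $U$. Initially $\mathcal P$ is the partition into singletons and $U=\binom V2$. In each step one of three operations is performed: merge two parts $A,B\in\mathcal P$, replacing them by $A\cup B$; resolve positively a pair of parts $A,B\in\mathcal P$ (possibly $A=B$), moving all $\{a,b\}\in U$ with $a\in A,b\in B$ from $U$ to $E$; or resolve negatively such a pair of parts, moving these pairs from $U$ to $N$. In the end $\mathcal P$ has one part and $U=\emptyset$; it is then a construction sequence of the graph $(V,E)$. Its radius-$r$ width is the least $k$ such that at every step, for every $v\in V$, at most $k$ parts of the current $\mathcal P$ contain a vertex reachable from $v$ by a path of length at most $r$ in the graph $(V,E\cup N)$ for the current $E,N$. The radius-$r$ merge-width $\mathrm{mw}_r(G)$ is the least radius-$r$ width of a construction sequence of $G$. A graph class $\mathcal C$ has bounded merge-width if $\sup_{G\in\mathcal C}\mathrm{mw}_r(G)<\infty$ for every $r\in\mathbb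 N$. *)

theory Defs
  imports Main "HOL-Library.Ramsey" "HOL-Library.Extended_Nat"
begin

record 'a graph =
  verts :: "'a set"
  edges :: "'a set set"

text \<open>The set \<open>[V]\<^bsup>2\<^esup>\<close> of all two-element subsets of \<open>V\<close> is \<^const>\<open>nsets\<close> from the
  library theory on Ramsey's theorem.\<close>

definition fin_graph :: "'a graph \<Rightarrow> bool" where
  "fin_graph G \<longleftrightarrow> finite (verts G) \<and> edges G \<subseteq> [verts G]\<^bsup>2\<^esup>"

text \<open>Variables are natural numbers; the remaining connectives and the universal quantifier are
  definable from these in the usual way.\<close>

datatype fo =
    Eq nat nat
  | Adj nat nat
  | Neg fo
  | Conj fo fo
  | Exists nat fo

primrec fv :: "fo \<Rightarrow> nat set" where
  "fv (Eq x y) = {x, y}"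
| "fv (Adj x y) = {x, y}"
| "fv (Neg \<phi>) = fv \<phi>"
| "fv (Conj \<phi> \<psi>) = fv \<phi> \<union> fv \<psi>"
| "fv (Exists x \<phi>) = fv \<phi> - {x}"

primrec sat :: "'a graph \<Rightarrow> (nat \<Rightarrow> 'a) \<Rightarrow> fo \<Rightarrow> bool" where
  "sat G s (Eq x y) \<longleftrightarrow> s x = s y"
| "sat G s (Adj x y) \<longleftrightarrow> {s x, s y} \<in> edges G"
| "sat G s (Neg \<phi>) \<longleftrightarrow> \<not> sat G s \<phi>"
| "sat G s (Conj \<phi> \<psi>) \<longleftrightarrow> sat G s \<phi> \<and> sat G s \<psi>"
| "sat G s (Exists x \<phi>) \<longleftrightarrow> (\<exists>a \<in> verts G. sat G (s(x := a)) \<phi>)"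

text \<open>A formula \<open>\<phi>(x,y)\<close> is one with \<open>fv \<phi> \<subseteq> {0, 1}\<close>: variable \<open>0\<close> plays the role of \<open>x\<close> and
  variable \<open>1\<close> that of \<open>y\<close>. The values of the assignment at all other variables are irrelevant
  for such formulas.\<close>

definition sat2 :: "'a graph \<Rightarrow> fo \<Rightarrow> 'a \<Rightarrow> 'a \<Rightarrow> bool" where
  "sat2 G \<phi> u v \<longleftrightarrow> sat G (\<lambda>n. if n = 0 then u else v) \<phi>"

definition interp :: "fo \<Rightarrow> 'a graph \<Rightarrow> 'a graph" where
  "interp \<phi> G = \<lparr> verts = verts G,
     edges = {{u, v} | u v. {u, v} \<in> [verts G]\<^bsup>2\<^esup> \<and> (sat2 G \<phi> u v \<or> sat2 G \<phi> v u)} \<rparr>"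

record 'a cstate =
  parts :: "'a set set"
  pos :: "'a set set"
  neg :: "'a set set"
  unres :: "'a set set"

definition init_state :: "'a set \<Rightarrow> 'a cstate" where
  "init_state V = \<lparr> parts = (\<lambda>v. {v}) ` V, pos = {}, neg = {}, unres = [V]\<^bsup>2\<^esup> \<rparr>"

definition pairs_between :: "'a set \<Rightarrow> 'a set \<Rightarrow> 'a set set" where
  "pairs_between A B = {{a, b} | a b. a \<in> A \<and> b \<in> B}"

inductive cstep :: "'a cstate \<Rightarrow> 'a cstate \<Rightarrow> bool" where
  merge: "A \<in> parts s \<Longrightarrow> B \<in> parts s \<Longrightarrow> A \<noteq> B \<Longrightarrow>
    cstep s (s\<lparr> parts := insert (A \<union> B) (parts s - {A, B}) \<rparr>)"
| resolve_pos: "A \<in> parts s \<Longrightarrow> B \<in> parts s \<Longrightarrow>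
    cstep s (s\<lparr> pos := pos s \<union> (unres s \<inter> pairs_between A B),
                unres := unres s - pairs_between A B \<rparr>)"
| resolve_neg: "A \<in> parts s \<Longrightarrow> B \<in> parts s \<Longrightarrow>
    cstep s (s\<lparr> neg := neg s \<union> (unres s \<inter> pairs_between A B),
                unres := unres s - pairs_between A B \<rparr>)"

text \<open>A construction sequence is represented by the list of all states it passes through, including
  the initial and the final one. The final partition of a nonempty vertex set has exactly one
  part; writing ``at most one'' only matters for the graph without vertices, whose sole partition
  is empty and which thereby also has a construction sequence.\<close>

definition construction_seq :: "'a graph \<Rightarrow> 'a cstate list \<Rightarrow> bool" where
  "construction_seq G ss \<longleftrightarrow>
     ss \<noteq> [] \<and> hd ss = init_state (verts G) \<and> successively cstep ss \<and>
     card (parts (last ss)) \<le> 1 \<and> unres (last ss) = {} \<and> pos (last ss) = edges G"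

definition is_path :: "'a graph \<Rightarrow> 'a list \<Rightarrow> bool" where
  "is_path G p \<longleftrightarrow> p \<noteq> [] \<and> set p \<subseteq> verts G \<and> distinct p \<and>
     successively (\<lambda>u v. {u, v} \<in> edges G) p"

text \<open>The length of a path is its number of edges.\<close>

definition reachable :: "'a graph \<Rightarrow> nat \<Rightarrow> 'a \<Rightarrow> 'a \<Rightarrow> bool" where
  "reachable G r v w \<longleftrightarrow> (\<exists>p. is_path G p \<and> hd p = v \<and> last p = w \<and> length p - 1 \<le> r)"

definition resolved_graph :: "'a set \<Rightarrow> 'a cstate \<Rightarrow> 'a graph" where
  "resolved_graph V s = \<lparr> verts = V, edges = pos s \<union> neg s \<rparr>"

definition reachable_parts :: "'a set \<Rightarrow> nat \<Rightarrow> 'a cstate \<Rightarrow> 'a \<Rightarrow> 'a set set" where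
  "reachable_parts V r s v = {A \<in> parts s. \<exists>w \<in> A. reachable (resolved_graph V s) r v w}"

definition seq_width :: "'a set \<Rightarrow> nat \<Rightarrow> 'a cstate list \<Rightarrow> nat" where
  "seq_width V r ss = (LEAST k. \<forall>s \<in> set ss. \<forall>v \<in> V. card (reachable_parts V r s v) \<le> k)"

text \<open>For a finite graph the set of construction sequences is nonempty, so the infimum is a finite
  number and is attained.\<close>

definition merge_width :: "nat \<Rightarrow> 'a graph \<Rightarrow> enat" where
  "merge_width r G = (INF ss \<in> {ss. construction_seq G ss}. enat (seq_width (verts G) r ss))"

definition bounded_merge_width :: "'a graph set \<Rightarrow> bool" where
  "bounded_merge_width C \<longleftrightarrow> (\<forall>r. (SUP G \<in> C. merge_width r G) < \<infinity>)"

end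

theory Submission
  imports Defs "HOL-Library.Disjoint_Sets"
begin

text \<open>Fix a formula \<open>\<phi>(x,y)\<close> of quantifier rank \<open>q\<close> and a construction sequence of \<open>G\<close>. A state \<open>s\<close> of
the sequence is seen as a structure on the vertices: the edges of \<open>G\<close>, the reflexive relation
\<open>S\<close> of resolved pairs, and one unary predicate for every part. What makes these structures tame is
that the pairs outside \<open>S\<close> between two given parts are either all edges or all non-edges: they will
be resolved at once later. So the edge relation is local with respect to \<open>S\<close>, up to the
parts of the two vertices.

The construction sequence for \<open>\<phi>(G)\<close> follows that of \<open>G\<close>. At state \<open>s\<close> its partition is the
partition of the vertices into types, that is, classes of indistinguishability in an
Ehrenfeucht-Fraisse game of a fixed large length \<open>n\<close> on the structure of \<open>s\<close>, and all pairs that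
it has resolved are at \<open>S\<close>-distance at most \<open>d = 4 ^ q\<close>. Four facts make this work.

\<^item> Types only get coarser with time, because the structure of the next state is definable without
  quantifiers from the current one (\<open>cstep_game\<close>). This is why the global game defines the types:
  types that only see a neighbourhood in \<open>S\<close> could be split when \<open>S\<close> grows.

\<^item> If \<open>u\<close> and \<open>v\<close> are further than \<open>d\<close> apart, then the types of \<open>u\<close> and \<open>v\<close> determine whether
  \<open>\<phi>(u,v)\<close> holds (\<open>types_homogeneous\<close>). This is a version of Gaifman's locality theorem, in the
  form that tuples far from each other can be composed in the game (\<open>clusters_game\<close>). Both tuples
  to be compared live in the same structure, which makes the argument short: the sentences of
  Gaifman's theorem, which speak about scattered sets of witnesses, agree automatically.

\<^item> The types can be merged and the pairs between them resolved without ever resolving a pair at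
  distance more than \<open>d\<close>, if one resolves a pair of types only when all its unresolved pairs are
  close (\<open>lazy_construction\<close>).

\<^item> A ball of bounded radius around a vertex meets few parts, so it meets few types
  (\<open>bounded_width_of_types\<close>). By the same locality theorem, the type of a vertex is determined by
  a game in which the players move only along \<open>S\<close>. Such a game sees only the parts that a ball
  meets, and so its number of classes is bounded in terms of the number of these parts
  (\<open>bounded_local_types\<close>).\<close>

section \<open>Ehrenfeucht-Fraisse games\<close>

text \<open>Positions of the games are binary relations, seen as sets of pairs of corresponding pebbles, and
not tuples. So the order of the pebbles never matters, the two sides are exchanged by the converse,
and games compose along relational composition.\<close>

definition partial_iso :: "'a set set \<Rightarrow> 'a rel \<Rightarrow> 'a set set \<Rightarrow> 'a rel \<Rightarrow> bool" where
  "partial_iso E S P p \<longleftrightarrow>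
     (\<forall>a b. (a, b) \<in> p \<longrightarrow> (\<forall>A\<in>P. a \<in> A \<longleftrightarrow> b \<in> A)) \<and>
     (\<forall>a b a' b'. (a, b) \<in> p \<longrightarrow> (a', b') \<in> p \<longrightarrow>
        (a = a' \<longleftrightarrow> b = b') \<and> ({a, a'} \<in> E \<longleftrightarrow> {b, b'} \<in> E) \<and> ((a, a') \<in> S \<longleftrightarrow> (b, b') \<in> S))"

text \<open>The game that characterises equivalence up to quantifier rank \<open>n\<close>, where both sides are played on the
same structure.\<close>

primrec game :: "'a set \<Rightarrow> 'a set set \<Rightarrow> 'a rel \<Rightarrow> 'a set set \<Rightarrow> nat \<Rightarrow> 'a rel \<Rightarrow> bool" where
  "game V E S P 0 p \<longleftrightarrow> partial_iso E S P p"
| "game V E S P (Suc n) p \<longleftrightarrow> game V E S P n p \<and>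
     (\<forall>w\<in>V. \<exists>w'\<in>V. game V E S P n (insert (w, w') p)) \<and>
     (\<forall>w'\<in>V. \<exists>w\<in>V. game V E S P n (insert (w, w') p))"

lemma converse_insert_pair: "(insert (a, b) p)\<inverse> = insert (b, a) (p\<inverse>)"
  by blast

lemma partial_isoD:
  assumes "partial_iso E S P p" "(a, b) \<in> p"
  shows "A \<in> P \<Longrightarrow> a \<in> A \<longleftrightarrow> b \<in> A"
    and "(a', b') \<in> p \<Longrightarrow> a = a' \<longleftrightarrow> b = b'"
    and "(a', b') \<in> p \<Longrightarrow> {a, a'} \<in> E \<longleftrightarrow> {b, b'} \<in> E"
    and "(a', b') \<in> p \<Longrightarrow> (a, a') \<in> S \<longleftrightarrow> (b, b') \<in> S"
  using assms by (simp_all add: partial_iso_def)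

lemma partial_iso_subset: "partial_iso E S P p \<Longrightarrow> q \<subseteq> p \<Longrightarrow> partial_iso E S P q"
  unfolding partial_iso_def by (simp add: subset_iff)

lemma partial_iso_Id: "p \<subseteq> Id \<Longrightarrow> partial_iso E S P p"
  unfolding partial_iso_def
proof (intro conjI allI impI)
  fix a b a' b' assume "p \<subseteq> Id" "(a, b) \<in> p" "(a', b') \<in> p"
  then have "a = b" "a' = b'" by auto
  then show "(a = a') = (b = b')" "({a, a'} \<in> E) = ({b, b'} \<in> E)" "((a, a') \<in> S) = ((b, b') \<in> S)"
    by simp_all
qed auto

lemma partial_iso_converse: "partial_iso E S P p \<Longrightarrow> partial_iso E S P (p\<inverse>)"
  unfolding partial_iso_def by simp

lemma partial_iso_relcomp:
  assumes "partial_iso E S P p" "partial_iso E S P q"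
  shows "partial_iso E S P (p O q)"
  unfolding partial_iso_def
proof (intro conjI allI impI)
  fix a c assume "(a, c) \<in> p O q"
  then obtain b where "(a, b) \<in> p" "(b, c) \<in> q" by (rule relcompE) simp
  with assms show "\<forall>A\<in>P. a \<in> A \<longleftrightarrow> c \<in> A" unfolding partial_iso_def by simp
next
  fix a c a' c' assume "(a, c) \<in> p O q" "(a', c') \<in> p O q"
  then obtain b b' where "(a, b) \<in> p" "(b, c) \<in> q" "(a', b') \<in> p" "(b', c') \<in> q"
    by (elim relcompE) blast
  with assms show "(a = a') = (c = c')" "({a, a'} \<in> E) = ({c, c'} \<in> E)" "((a, a') \<in> S) = ((c, c') \<in> S)"
    unfolding partial_iso_def by simp_all
qed

lemma game_forth:
  "game V E S P (Suc n) p \<Longrightarrow> w \<in> V \<Longrightarrow> \<exists>w'\<in>V. game V E S P n (insert (w, w') p)"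
  by simp

lemma game_back:
  "game V E S P (Suc n) p \<Longrightarrow> w' \<in> V \<Longrightarrow> \<exists>w\<in>V. game V E S P n (insert (w, w') p)"
  by simp

lemma game_SucI:
  assumes "game V E S P n p"
    and "\<And>w. w \<in> V \<Longrightarrow> \<exists>w'\<in>V. game V E S P n (insert (w, w') p)"
    and "\<And>w'. w' \<in> V \<Longrightarrow> \<exists>w\<in>V. game V E S P n (insert (w, w') p)"
  shows "game V E S P (Suc n) p"
  using assms by simp

lemma game_partial_iso: "game V E S P n p \<Longrightarrow> partial_iso E S P p"
  by (induction n) auto

lemma game_antimono: "game V E S P n p \<Longrightarrow> m \<le> n \<Longrightarrow> game V E S P m p"
  by (induction n) (auto simp: le_Suc_eq)

lemma game_subset: "game V E S P n p \<Longrightarrow> q \<subseteq> p \<Longrightarrow> game V E S P n q"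
proof (induction n arbitrary: p q)
  case 0 then show ?case by (simp add: partial_iso_subset)
next
  case (Suc n)
  have *: "game V E S P n (insert e q)" if "game V E S P n (insert e p)" for e
    using that insert_mono[OF Suc.prems(2)] by (rule Suc.IH)
  show ?case
  proof (rule game_SucI)
    show "game V E S P n q" using Suc.prems Suc.IH[of p q] by simp
  next
    fix w assume "w \<in> V"
    with game_forth[OF Suc.prems(1)] show "\<exists>w'\<in>V. game V E S P n (insert (w, w') q)"
      by (meson *)
  next
    fix w' assume "w' \<in> V"
    with game_back[OF Suc.prems(1)] show "\<exists>w\<in>V. game V E S P n (insert (w, w') q)"
      by (meson *)
  qed
qed

lemma game_Id: "p \<subseteq> Id \<Longrightarrow> game V E S P n p"
proof (induction n arbitrary: p)
  case 0 then show ?case by (simp add: partial_iso_Id)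
next
  case (Suc n)
  have *: "game V E S P n (insert (w, w) p)" for w
    using Suc.prems by (intro Suc.IH) simp
  show ?case
  proof (rule game_SucI)
    show "game V E S P n p" using Suc.prems by (rule Suc.IH)
  next
    fix w assume "w \<in> V"
    with * show "\<exists>w'\<in>V. game V E S P n (insert (w, w') p)" by (rule bexI)
  next
    fix w assume "w \<in> V"
    with * show "\<exists>w'\<in>V. game V E S P n (insert (w', w) p)" by (rule bexI)
  qed
qed

lemma game_converse: "game V E S P n p \<Longrightarrow> game V E S P n (p\<inverse>)"
proof (induction n arbitrary: p)
  case 0 then show ?case by (simp add: partial_iso_converse)
next
  case (Suc n)
  have *: "game V E S P n (insert (w', w) (p\<inverse>))" if "game V E S P n (insert (w, w') p)" for w w'
    using Suc.IH[OF that] by (simp add: converse_insert_pair)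
  show ?case
  proof (rule game_SucI)
    show "game V E S P n (p\<inverse>)" using Suc by simp
  next
    fix w assume "w \<in> V"
    with game_back[OF Suc.prems] show "\<exists>w'\<in>V. game V E S P n (insert (w, w') (p\<inverse>))"
      by (meson *)
  next
    fix w' assume "w' \<in> V"
    with game_forth[OF Suc.prems] show "\<exists>w\<in>V. game V E S P n (insert (w, w') (p\<inverse>))"
      by (meson *)
  qed
qed

lemma game_relcomp: "game V E S P n p \<Longrightarrow> game V E S P n q \<Longrightarrow> game V E S P n (p O q)"
proof (induction n arbitrary: p q)
  case 0 then show ?case by (simp add: partial_iso_relcomp)
next
  case (Suc n)
  have *: "game V E S P n (insert (w, w'') (p O q))"
    if "game V E S P n (insert (w, w') p)" "game V E S P n (insert (w', w'') q)" for w w' w''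
  proof (rule game_subset[OF Suc.IH[OF that]])
    show "insert (w, w'') (p O q) \<subseteq> insert (w, w') p O insert (w', w'') q"
      by (intro insert_subsetI relcomp_mono subset_insertI relcompI[of _ w'] insertI1)
  qed
  show ?case
  proof (rule game_SucI)
    show "game V E S P n (p O q)"
      using Suc.prems[THEN game_antimono, of n] by (intro Suc.IH) simp_all
  next
    fix w assume "w \<in> V"
    from game_forth[OF Suc.prems(1) this]
    obtain w' where w': "w' \<in> V" "game V E S P n (insert (w, w') p)" by (rule bexE)
    from game_forth[OF Suc.prems(2) w'(1)]
    obtain w'' where "w'' \<in> V" "game V E S P n (insert (w', w'') q)" by (rule bexE)
    then show "\<exists>w''\<in>V. game V E S P n (insert (w, w'') (p O q))"
      by (intro bexI[of _ w''] *[OF w'(2)])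
  next
    fix w'' assume "w'' \<in> V"
    from game_back[OF Suc.prems(2) this]
    obtain w' where w': "w' \<in> V" "game V E S P n (insert (w', w'') q)" by (rule bexE)
    from game_back[OF Suc.prems(1) w'(1)]
    obtain w where "w \<in> V" "game V E S P n (insert (w, w') p)" by (rule bexE)
    then show "\<exists>w\<in>V. game V E S P n (insert (w, w'') (p O q))"
      by (intro bexI[of _ w] *[OF _ w'(2)])
  qed
qed

section \<open>Games with local moves\<close>

text \<open>The variant in which a pebble has to be placed on a neighbour, with respect to \<open>S\<close>, of a vertex that
already carries a pebble.\<close>

primrec local_game :: "'a set set \<Rightarrow> 'a rel \<Rightarrow> 'a set set \<Rightarrow> nat \<Rightarrow> 'a rel \<Rightarrow> bool" where
  "local_game E S P 0 p \<longleftrightarrow> partial_iso E S P p"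
| "local_game E S P (Suc n) p \<longleftrightarrow> local_game E S P n p \<and>
     (\<forall>a b w. (a, b) \<in> p \<longrightarrow> (a, w) \<in> S \<longrightarrow>
        (\<exists>w'. (b, w') \<in> S \<and> local_game E S P n (insert (w, w') p))) \<and>
     (\<forall>a b w'. (a, b) \<in> p \<longrightarrow> (b, w') \<in> S \<longrightarrow>
        (\<exists>w. (a, w) \<in> S \<and> local_game E S P n (insert (w, w') p)))"

lemma local_game_partial_iso: "local_game E S P n p \<Longrightarrow> partial_iso E S P p"
  by (induction n) auto

lemma local_game_antimono: "local_game E S P n p \<Longrightarrow> m \<le> n \<Longrightarrow> local_game E S P m p"
  by (induction n) (auto simp: le_Suc_eq)

lemma local_game_stepD:
  assumes "local_game E S P (Suc n) p" "(a, b) \<in> p" "(a, w) \<in> S"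
  shows "\<exists>w'. (b, w') \<in> S \<and> local_game E S P n (insert (w, w') p)"
  using assms by simp

lemma local_game_stepD2:
  assumes "local_game E S P (Suc n) p" "(a, b) \<in> p" "(b, w') \<in> S"
  shows "\<exists>w. (a, w) \<in> S \<and> local_game E S P n (insert (w, w') p)"
  using assms by simp

lemma local_game_SucI:
  assumes "local_game E S P n p"
    and "\<And>a b w. (a, b) \<in> p \<Longrightarrow> (a, w) \<in> S \<Longrightarrow> \<exists>w'. (b, w') \<in> S \<and> local_game E S P n (insert (w, w') p)"
    and "\<And>a b w'. (a, b) \<in> p \<Longrightarrow> (b, w') \<in> S \<Longrightarrow> \<exists>w. (a, w) \<in> S \<and> local_game E S P n (insert (w, w') p)"
  shows "local_game E S P (Suc n) p"
  using assms by simp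

lemma local_game_subset: "local_game E S P n p \<Longrightarrow> q \<subseteq> p \<Longrightarrow> local_game E S P n q"
proof (induction n arbitrary: p q)
  case 0 then show ?case by (simp add: partial_iso_subset)
next
  case (Suc n)
  have *: "local_game E S P n (insert e q)" if "local_game E S P n (insert e p)" for e
    using that insert_mono[OF Suc.prems(2)] by (rule Suc.IH)
  show ?case
  proof (rule local_game_SucI)
    show "local_game E S P n q" using Suc.prems Suc.IH[of p q] by simp
  next
    fix a b w assume "(a, b) \<in> q" "(a, w) \<in> S"
    with Suc.prems(2) local_game_stepD[OF Suc.prems(1)]
    show "\<exists>w'. (b, w') \<in> S \<and> local_game E S P n (insert (w, w') q)" by (meson * subsetD)
  next
    fix a b w' assume "(a, b) \<in> q" "(b, w') \<in> S"
    with Suc.prems(2) local_game_stepD2[OF Suc.prems(1)]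
    show "\<exists>w. (a, w) \<in> S \<and> local_game E S P n (insert (w, w') q)" by (meson * subsetD)
  qed
qed

lemma local_game_Id: "p \<subseteq> Id \<Longrightarrow> local_game E S P n p"
proof (induction n arbitrary: p)
  case 0 then show ?case by (simp add: partial_iso_Id)
next
  case (Suc n)
  have *: "local_game E S P n (insert (w, w) p)" for w using Suc by simp
  show ?case
  proof (rule local_game_SucI)
    show "local_game E S P n p" using Suc by simp
  next
    fix a b w assume "(a, b) \<in> p" "(a, w) \<in> S"
    with Suc.prems have "(b, w) \<in> S" by blast
    with * show "\<exists>w'. (b, w') \<in> S \<and> local_game E S P n (insert (w, w') p)" by meson
  next
    fix a b w assume "(a, b) \<in> p" "(b, w) \<in> S"
    with Suc.prems have "(a, w) \<in> S" by blast
    with * show "\<exists>w'. (a, w') \<in> S \<and> local_game E S P n (insert (w', w) p)" by meson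
  qed
qed

lemma local_game_converse: "local_game E S P n p \<Longrightarrow> local_game E S P n (p\<inverse>)"
proof (induction n arbitrary: p)
  case 0 then show ?case by (simp add: partial_iso_converse)
next
  case (Suc n)
  have *: "local_game E S P n (insert (w', w) (p\<inverse>))" if "local_game E S P n (insert (w, w') p)" for w w'
    using Suc.IH[OF that] by (simp add: converse_insert_pair)
  show ?case
  proof (rule local_game_SucI)
    show "local_game E S P n (p\<inverse>)" using Suc.prems Suc.IH[of p] by simp
  next
    fix a b w assume "(a, b) \<in> p\<inverse>" "(a, w) \<in> S"
    with local_game_stepD2[OF Suc.prems, of b a w] *
    show "\<exists>w'. (b, w') \<in> S \<and> local_game E S P n (insert (w, w') (p\<inverse>))" by auto
  next
    fix a b w' assume "(a, b) \<in> p\<inverse>" "(b, w') \<in> S"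
    with local_game_stepD[OF Suc.prems, of b a w'] *
    show "\<exists>w. (a, w) \<in> S \<and> local_game E S P n (insert (w, w') (p\<inverse>))" by auto
  qed
qed

lemma local_game_relcomp:
  "local_game E S P n p \<Longrightarrow> local_game E S P n q \<Longrightarrow> local_game E S P n (p O q)"
proof (induction n arbitrary: p q)
  case 0 then show ?case by (simp add: partial_iso_relcomp)
next
  case (Suc n)
  have comp: "local_game E S P n (insert (w, w'') (p O q))"
    if "local_game E S P n (insert (w, w') p)" "local_game E S P n (insert (w', w'') q)" for w w' w''
  proof (rule local_game_subset[OF Suc.IH[OF that]])
    show "insert (w, w'') (p O q) \<subseteq> insert (w, w') p O insert (w', w'') q"
      by (intro insert_subsetI relcomp_mono subset_insertI relcompI[of _ w'] insertI1)
  qed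
  show ?case
  proof (rule local_game_SucI)
    show "local_game E S P n (p O q)" using Suc.prems Suc.IH[of p q] by simp
  next
    fix a c w assume "(a, c) \<in> p O q" "(a, w) \<in> S"
    then obtain b where b: "(a, b) \<in> p" "(b, c) \<in> q" by blast
    show "\<exists>w'. (c, w') \<in> S \<and> local_game E S P n (insert (w, w') (p O q))"
      using local_game_stepD[OF Suc.prems(1) b(1) \<open>(a, w) \<in> S\<close>] local_game_stepD[OF Suc.prems(2) b(2)]
      by (meson comp)
  next
    fix a c w assume "(a, c) \<in> p O q" "(c, w) \<in> S"
    then obtain b where b: "(a, b) \<in> p" "(b, c) \<in> q" by blast
    show "\<exists>w'. (a, w') \<in> S \<and> local_game E S P n (insert (w', w) (p O q))"
      using local_game_stepD2[OF Suc.prems(2) b(2) \<open>(c, w) \<in> S\<close>] local_game_stepD2[OF Suc.prems(1) b(1)]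
      by (meson comp)
  qed
qed

text \<open>Local moves can be answered as in the global game, since the position after the move has to be a
partial isomorphism for \<open>S\<close>, so that the answer is local as well.\<close>

lemma game_local_game:
  assumes "S \<subseteq> V \<times> V"
  shows "game V E S P n p \<Longrightarrow> local_game E S P n p"
proof (induction n arbitrary: p)
  case 0 then show ?case by simp
next
  case (Suc n)
  show ?case
  proof (rule local_game_SucI)
    show "local_game E S P n p" using Suc by simp
  next
    fix a b w assume ab: "(a, b) \<in> p" "(a, w) \<in> S"
    then obtain w' where w': "game V E S P n (insert (w, w') p)"
      using game_forth[OF Suc.prems, of w] assms by blast
    with partial_isoD(4)[OF game_partial_iso[OF w'], of a b w w'] ab have "(b, w') \<in> S" by simp
    with Suc.IH[OF w'] show "\<exists>w'. (b, w') \<in> S \<and> local_game E S P n (insert (w, w') p)" by blast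
  next
    fix a b w' assume ab: "(a, b) \<in> p" "(b, w') \<in> S"
    then obtain w where w: "game V E S P n (insert (w, w') p)"
      using game_back[OF Suc.prems, of w'] assms by blast
    with partial_isoD(4)[OF game_partial_iso[OF w], of a b w w'] ab have "(a, w) \<in> S" by simp
    with Suc.IH[OF w] show "\<exists>w. (a, w) \<in> S \<and> local_game E S P n (insert (w, w') p)" by blast
  qed
qed

text \<open>A vertex at distance \<open>d\<close> from a pebble is reached by \<open>d\<close> local moves along a path, of which only the
last pebble is kept.\<close>

lemma local_game_reach:
  assumes "local_game E S P (k + d) p" "(a, b) \<in> p" "(a, w) \<in> S ^^ d"
  shows "\<exists>w'. (b, w') \<in> S ^^ d \<and> local_game E S P k (insert (w, w') p)"
  using assms
proof (induction d arbitrary: k w)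
  case 0
  then show ?case by (auto simp: insert_absorb)
next
  case (Suc d)
  then obtain c where c: "(a, c) \<in> S ^^ d" "(c, w) \<in> S" by auto
  from Suc.IH[of "Suc k" c] Suc.prems c obtain c' where
    c': "(b, c') \<in> S ^^ d" "local_game E S P (Suc k) (insert (c, c') p)" by auto
  from local_game_stepD[OF c'(2) _ c(2)] obtain w' where
    w': "(c', w') \<in> S" "local_game E S P k (insert (w, w') (insert (c, c') p))" by blast
  from local_game_subset[OF w'(2)] have "local_game E S P k (insert (w, w') p)" by blast
  with relpow_Suc_I[OF c'(1) w'(1)] show ?case by blast
qed

lemma local_game_distance:
  assumes "local_game E S P d p" "(a, b) \<in> p" "(a', b') \<in> p" "(a, a') \<in> S ^^ d"
  shows "(b, b') \<in> S ^^ d"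
proof -
  obtain c where c: "(b, c) \<in> S ^^ d" "local_game E S P 0 (insert (a', c) p)"
    using local_game_reach[of E S P 0 d p, OF _ assms(2,4)] assms(1) by auto
  then have "c = b'" using partial_isoD(2)[of E S P _ a' c a' b'] assms(3) by simp
  with c show ?thesis by simp
qed

text \<open>This transfers a configuration of vertices around the right pebbles to the left side. It will be
applied to scattered sets: by \<open>local_game_distance\<close> the copy is as scattered as the original.\<close>

lemma local_game_reach_set:
  assumes "finite X" "local_game E S P (k + card X * d) p" "X \<subseteq> (S ^^ d) `` Range p"
  shows "\<exists>g. (\<forall>x\<in>X. g x \<in> (S ^^ d) `` Domain p) \<and> local_game E S P k (p \<union> (\<lambda>x. (g x, x)) ` X)"
  using assms
proof (induction X arbitrary: k rule: finite_induct)
  case empty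
  then show ?case by simp
next
  case (insert x X)
  have "local_game E S P ((k + d) + card X * d) p"
    using insert by (simp add: algebra_simps)
  with insert.IH[of "k + d"] insert.prems obtain g where
    g: "\<forall>x\<in>X. g x \<in> (S ^^ d) `` Domain p" "local_game E S P (k + d) (p \<union> (\<lambda>x. (g x, x)) ` X)" by blast
  obtain a b where ab: "(a, b) \<in> p" "(b, x) \<in> S ^^ d" using insert.prems by blast
  let ?p = "p \<union> (\<lambda>x. (g x, x)) ` X"
  from local_game_reach[OF local_game_converse[OF g(2)], of b a x] ab obtain w where
    w: "(a, w) \<in> S ^^ d" "local_game E S P k (insert (x, w) (?p\<inverse>))" by blast
  from local_game_converse[OF w(2)] have "local_game E S P k (insert (w, x) ?p)"
    by (simp add: converse_insert_pair)
  moreover have "insert (w, x) ?p = p \<union> (\<lambda>y. ((g(x := w)) y, y)) ` insert x X"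
    using insert.hyps by auto
  ultimately have "local_game E S P k (p \<union> (\<lambda>y. ((g(x := w)) y, y)) ` insert x X)" by simp
  moreover have "\<forall>y\<in>insert x X. (g(x := w)) y \<in> (S ^^ d) `` Domain p"
    using g w ab by auto
  ultimately show ?case by blast
qed

section \<open>Locality\<close>

lemma relpow_sym: "sym S \<Longrightarrow> (x, y) \<in> S ^^ d \<Longrightarrow> (y, x) \<in> S ^^ d"
proof (induction d arbitrary: y)
  case (Suc d)
  from Suc.prems(2) obtain z where z: "(x, z) \<in> S ^^ d" "(z, y) \<in> S" by auto
  with Suc.prems(1) have "(y, z) \<in> S" by (auto dest: symD)
  from relpow_Suc_I2[OF this Suc.IH[OF Suc.prems(1) z(1)]] show ?case .
qed simp

lemma relpow_range:
  assumes "S \<subseteq> V \<times> V" "(x, y) \<in> S ^^ d" "x \<in> V"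
  shows "y \<in> V"
  using assms(2) by (cases d) (use assms in auto)

lemma relpow_mono_exponent:
  assumes "S \<subseteq> V \<times> V" "refl_on V S" "x \<in> V" "(x, y) \<in> S ^^ i" "i \<le> j"
  shows "(x, y) \<in> S ^^ j"
proof -
  have "(y, y) \<in> S ^^ k" for k
    using relpow_range[OF assms(1,4,3)] assms(2)
    by (induction k) (auto simp: refl_on_def)
  from relpow_trans[OF assms(4) this[of "j - i"]] \<open>i \<le> j\<close> show ?thesis by simp
qed

text \<open>The length of the local games that is needed to win \<open>n\<close> rounds of the global game with at most \<open>M\<close>
pebbles. The next round of the global game costs the summand \<open>(M + 5) * 4 ^ n\<close>: either a walk of
\<open>3 * 4 ^ n\<close> local moves, or the transfer of at most \<open>M\<close> vertices over a distance \<open>4 ^ n\<close> while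
keeping \<open>2 * 4 ^ n\<close> moves for comparing their distances.\<close>

primrec level :: "nat \<Rightarrow> nat \<Rightarrow> nat" where
  "level M 0 = 0"
| "level M (Suc n) = level M n + (M + 5) * 4 ^ n"

text \<open>The abstract situation at a state: \<open>P\<close> is the partition, \<open>S\<close> relates equal vertices and vertices
that form a resolved pair, and \<open>E\<close> is the edge set of the final graph.\<close>

locale homogeneous_partition =
  fixes V :: "'a set" and E :: "'a set set" and S :: "'a rel" and P :: "'a set set"
  assumes finite_V: "finite V"
    and S_subset: "S \<subseteq> V \<times> V" and S_refl: "refl_on V S" and S_sym: "sym S"
    and P_covers: "\<Union>P = V"
    and homogeneous: "A \<in> P \<Longrightarrow> B \<in> P \<Longrightarrow> a \<in> A \<Longrightarrow> a' \<in> A \<Longrightarrow> b \<in> B \<Longrightarrow> b' \<in> B \<Longrightarrow>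
      (a, b) \<notin> S \<Longrightarrow> (a', b') \<notin> S \<Longrightarrow> {a, b} \<in> E \<longleftrightarrow> {a', b'} \<in> E"
begin

lemma near_mono: "(x, y) \<in> S ^^ i \<Longrightarrow> x \<in> V \<Longrightarrow> i \<le> j \<Longrightarrow> (x, y) \<in> S ^^ j"
  using relpow_mono_exponent[OF S_subset S_refl] by blast

lemma near_sym: "(x, y) \<in> S ^^ d \<Longrightarrow> (y, x) \<in> S ^^ d"
  by (rule relpow_sym[OF S_sym])

lemma near_refl: "x \<in> V \<Longrightarrow> (x, x) \<in> S ^^ d"
  using near_mono[of x x 0 d] by simp

lemma near_in_V: "(x, y) \<in> S ^^ d \<Longrightarrow> x \<in> V \<Longrightarrow> y \<in> V"
  by (rule relpow_range[OF S_subset])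

definition far_apart :: "nat \<Rightarrow> 'a rel \<Rightarrow> 'a rel \<Rightarrow> bool" where
  "far_apart d q q' \<longleftrightarrow> (\<forall>a b a' b'. (a, b) \<in> q \<longrightarrow> (a', b') \<in> q' \<longrightarrow>
     (a, a') \<notin> S ^^ d \<and> (b, b') \<notin> S ^^ d)"

text \<open>A position that the second player can survive for \<open>n\<close> rounds: it splits into clusters that are
pairwise far apart on both sides, and within each cluster even the long local game is won. The
distance is divided by four with every round, since a new pebble joins a cluster
from up to \<open>3 * 4 ^ n\<close> away and then has to keep distance \<open>4 ^ n\<close> from the others.\<close>

definition clusters :: "nat \<Rightarrow> nat \<Rightarrow> 'a rel set \<Rightarrow> bool" where
  "clusters M n Q \<longleftrightarrow> finite Q \<and> \<Union>Q \<subseteq> V \<times> V \<and> card (\<Union>Q) + n \<le> M \<and>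
     (\<forall>q\<in>Q. local_game E S P (level M n) q) \<and>
     (\<forall>q\<in>Q. \<forall>q'\<in>Q. q \<noteq> q' \<longrightarrow> far_apart (4 ^ n) q q')"

lemma far_apart_sym: "far_apart d q q' \<Longrightarrow> far_apart d q' q"
  unfolding far_apart_def using near_sym by blast

lemma clusters_converse:
  assumes "clusters M n Q" shows "clusters M n (converse ` Q)"
proof -
  have "\<Union> (converse ` Q) = (\<Union>Q)\<inverse>" by auto
  moreover have "card ((\<Union>Q)\<inverse>) = card (\<Union>Q)"
    by (simp add: card_inverse)
  moreover have "local_game E S P (level M n) (q\<inverse>)" if "q \<in> Q" for q
    using assms that by (simp add: clusters_def local_game_converse)
  moreover have "far_apart (4 ^ n) (q\<inverse>) (q'\<inverse>)" if "q \<in> Q" "q' \<in> Q" "q\<inverse> \<noteq> q'\<inverse>" for q q'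
  proof -
    have "far_apart (4 ^ n) q q'" using assms that by (auto simp: clusters_def)
    then show ?thesis by (simp add: far_apart_def)
  qed
  moreover have "(\<Union>Q)\<inverse> \<subseteq> V \<times> V" using assms by (auto simp: clusters_def)
  ultimately show ?thesis using assms by (simp add: clusters_def)
qed

text \<open>Two pebbles in different clusters are not related by \<open>S\<close>, so by homogeneity their parts, which the
partial isomorphisms of the clusters preserve, determine whether they are adjacent.\<close>

lemma partial_iso_far:
  assumes "clusters M 0 Q"
  shows "partial_iso E S P (\<Union>Q)"
  unfolding partial_iso_def
proof (intro conjI allI impI)
  have iso: "partial_iso E S P q" if "q \<in> Q" for q
    using assms that by (simp add: clusters_def)
  fix a b assume "(a, b) \<in> \<Union>Q"
  then obtain q where q: "(a, b) \<in> q" "q \<in> Q" by blast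
  show "\<forall>A\<in>P. (a \<in> A) = (b \<in> A)"
    using partial_isoD(1)[OF iso[OF q(2)] q(1)] by blast
  fix a' b' assume "(a', b') \<in> \<Union>Q"
  then obtain q' where q': "(a', b') \<in> q'" "q' \<in> Q" by blast
  have "(a = a') = (b = b') \<and> ({a, a'} \<in> E) = ({b, b'} \<in> E) \<and> ((a, a') \<in> S) = ((b, b') \<in> S)"
  proof (cases "q = q'")
    case True
    with q q' show ?thesis
      using partial_isoD(2-)[OF iso[OF q(2)] q(1), of a' b'] by simp
  next
    case False
    then have "far_apart 1 q q'" using assms q q' by (simp add: clusters_def)
    then have far: "(a, a') \<notin> S" "(b, b') \<notin> S"
      using q q' unfolding far_apart_def by auto
    have V: "a \<in> V" "a' \<in> V" "b \<in> V" using q q' assms unfolding clusters_def by auto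
    then obtain A A' where A: "A \<in> P" "a \<in> A" "A' \<in> P" "a' \<in> A'" using P_covers by blast
    then have "b \<in> A" "b' \<in> A'"
      using partial_isoD(1)[OF iso[OF q(2)] q(1)] partial_isoD(1)[OF iso[OF q'(2)] q'(1)] by auto
    from homogeneous[OF A(1,3) A(2) this(1) A(4) this(2) far]
    have "({a, a'} \<in> E) = ({b, b'} \<in> E)" .
    moreover have "a \<noteq> a'" "b \<noteq> b'" using far S_refl V unfolding refl_on_def by auto
    ultimately show ?thesis using far by simp
  qed
  then show "(a = a') = (b = b')" "({a, a'} \<in> E) = ({b, b'} \<in> E)"
    "((a, a') \<in> S) = ((b, b') \<in> S)" by blast+
qed

lemma far_apart_antimono:
  assumes "far_apart j q q'" "q \<subseteq> V \<times> V" "i \<le> j"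
  shows "far_apart i q q'"
  unfolding far_apart_def
proof (intro allI impI)
  fix a b a' b' assume ab: "(a, b) \<in> q" "(a', b') \<in> q'"
  with assms(2) have "a \<in> V" "b \<in> V" by auto
  with near_mono[OF _ _ assms(3)] assms(1) ab
  show "(a, a') \<notin> S ^^ i \<and> (b, b') \<notin> S ^^ i" unfolding far_apart_def by blast
qed

lemma local_game_pair_distance:
  assumes "local_game E S P d p" "(a, b) \<in> p" "(a', b') \<in> p"
  shows "(a, a') \<in> S ^^ d \<longleftrightarrow> (b, b') \<in> S ^^ d"
proof
  show "(a, a') \<in> S ^^ d \<Longrightarrow> (b, b') \<in> S ^^ d"
    by (rule local_game_distance[OF assms])
  show "(b, b') \<in> S ^^ d \<Longrightarrow> (a, a') \<in> S ^^ d"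
    using local_game_distance[OF local_game_converse[OF assms(1)], of b a b' a'] assms(2,3) by simp
qed

text \<open>Bookkeeping for both cases of a move: the new pebble extends one cluster (\<open>R\<close> consists of this cluster)
or forms a cluster of its own (\<open>R\<close> is empty).\<close>

lemma clusters_insert:
  assumes Q: "clusters M (Suc n) Q" and R: "R \<subseteq> Q"
    and w: "w \<in> V" "w' \<in> V" and p: "p = insert (w, w') (\<Union>R)"
    and game: "local_game E S P (level M n) p"
    and far: "\<And>q a b. q \<in> Q \<Longrightarrow> q \<notin> R \<Longrightarrow> (a, b) \<in> q \<Longrightarrow> (a, w) \<notin> S ^^ (4 ^ n) \<and> (b, w') \<notin> S ^^ (4 ^ n)"
  shows "clusters M n (insert p (Q - R)) \<and> \<Union>(insert p (Q - R)) = insert (w, w') (\<Union>Q)"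
proof
  show U: "\<Union>(insert p (Q - R)) = insert (w, w') (\<Union>Q)"
    unfolding p using R by (simp add: Un_Union_image Union_Un_distrib[symmetric] Un_absorb1 flip: Un_assoc)
  have sub: "\<Union>Q \<subseteq> V \<times> V" using Q by (simp add: clusters_def)
  have fin: "finite (\<Union>Q)" by (rule finite_subset[OF sub finite_cartesian_product[OF finite_V finite_V]])
  have far_p: "far_apart (4 ^ n) q p" if "q \<in> Q - R" for q
    unfolding far_apart_def
  proof (intro allI impI)
    fix a b a' b' assume ab: "(a, b) \<in> q" "(a', b') \<in> p"
    show "(a, a') \<notin> S ^^ 4 ^ n \<and> (b, b') \<notin> S ^^ 4 ^ n"
    proof (cases "(a', b') = (w, w')")
      case True then show ?thesis using far[of q a b] that ab by simp
    next
      case False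
      then obtain q' where q': "q' \<in> R" "(a', b') \<in> q'" using p ab by auto
      with that R have "q' \<in> Q" "q \<noteq> q'" by auto
      with Q that have "far_apart (4 ^ Suc n) q q'" unfolding clusters_def by simp
      then have "far_apart (4 ^ n) q q'"
        by (rule far_apart_antimono) (use sub that in auto)
      then show ?thesis using ab q' by (simp add: far_apart_def)
    qed
  qed
  have far_Q: "far_apart (4 ^ n) q q'" if "q \<in> Q" "q' \<in> Q" "q \<noteq> q'" for q q'
  proof (rule far_apart_antimono)
    show "far_apart (4 ^ Suc n) q q'" using Q that by (simp add: clusters_def)
  qed (use sub that in auto)
  show "clusters M n (insert p (Q - R))"
    unfolding clusters_def
  proof (intro conjI ballI impI)
    show "finite (insert p (Q - R))" using Q by (simp add: clusters_def)
    show "\<Union>(insert p (Q - R)) \<subseteq> V \<times> V" unfolding U using sub w by simp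
    have "card (insert (w, w') (\<Union>Q)) \<le> Suc (card (\<Union>Q))" by (rule card_insert_le_m1) simp_all
    also have "Suc (card (\<Union>Q)) + n \<le> M" using Q by (simp add: clusters_def)
    finally show "card (\<Union>(insert p (Q - R))) + n \<le> M" unfolding U by simp
  next
    fix q assume q: "q \<in> insert p (Q - R)"
    show "local_game E S P (level M n) q"
    proof (cases "q = p")
      case False
      with q Q have "local_game E S P (level M (Suc n)) q" by (simp add: clusters_def)
      then show ?thesis by (rule local_game_antimono) simp
    qed (use game in simp)
    fix q' assume q': "q' \<in> insert p (Q - R)" "q \<noteq> q'"
    consider "q = p" "q' \<in> Q - R" | "q' = p" "q \<in> Q - R" | "q \<in> Q" "q' \<in> Q"
      using q q' by blast
    then show "far_apart (4 ^ n) q q'"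
    proof cases
      case 1 then show ?thesis using far_apart_sym[OF far_p] by simp
    next
      case 2 then show ?thesis using far_p by simp
    next
      case 3 then show ?thesis using far_Q q' by simp
    qed
  qed
qed

definition scattered :: "nat \<Rightarrow> 'a set \<Rightarrow> bool" where
  "scattered d X \<longleftrightarrow> (\<forall>x\<in>X. \<forall>y\<in>X. x \<noteq> y \<longrightarrow> (x, y) \<notin> S ^^ d)"

text \<open>The heart of the locality argument. Let \<open>w\<close> be far from all left pebbles and suppose that every
vertex \<open>x\<close> that looks locally like \<open>w\<close> is close to a right pebble. Take a largest scattered set \<open>X\<close> of
such vertices; it has at most one element per right pebble. The part of \<open>X\<close> near a cluster can be
copied to the left side of this cluster by the local game. Since the clusters are far apart, the union of the
copies is scattered, and so it remains after adding \<open>w\<close>. This is a larger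
scattered set of vertices that look like \<open>w\<close>, a contradiction.\<close>

lemma far_witness:
  assumes Q: "clusters M (Suc n) Q" and w: "w \<in> V"
    and far: "\<And>q a b. q \<in> Q \<Longrightarrow> (a, b) \<in> q \<Longrightarrow> (a, w) \<notin> S ^^ (3 * 4 ^ n)"
  shows "\<exists>w'\<in>V. local_game E S P (level M n) {(w, w')} \<and>
    (\<forall>q\<in>Q. \<forall>a b. (a, b) \<in> q \<longrightarrow> (b, w') \<notin> S ^^ (4 ^ n))"
proof (rule ccontr)
  assume contra: "\<not> ?thesis"
  define d :: nat where "d = 4 ^ n"
  define T where "T = {x \<in> V. local_game E S P (level M n) {(w, x)}}"
  have sub: "\<Union>Q \<subseteq> V \<times> V" using Q by (simp add: clusters_def)
  have fin: "finite (\<Union>Q)" by (rule finite_subset[OF sub finite_cartesian_product[OF finite_V finite_V]])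
  have "\<forall>x\<in>T. \<exists>q b. q \<in> Q \<and> b \<in> Range q \<and> (b, x) \<in> S ^^ d"
    using contra unfolding T_def d_def by blast
  then obtain cl ce where cl: "\<And>x. x \<in> T \<Longrightarrow> cl x \<in> Q \<and> ce x \<in> Range (cl x) \<and> (ce x, x) \<in> S ^^ d"
    by metis
  have "\<exists>X. (X \<subseteq> T \<and> scattered (2 * d) X) \<and> (\<forall>Y. Y \<subseteq> T \<and> scattered (2 * d) Y \<longrightarrow> card Y \<le> card X)"
  proof (rule ex_has_greatest_nat[of _ "{}" card "Suc (card V)"])
    show "{} \<subseteq> T \<and> scattered (2 * d) {}" by (simp add: scattered_def)
    show "\<forall>Y. Y \<subseteq> T \<and> scattered (2 * d) Y \<longrightarrow> card Y < Suc (card V)"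
      using finite_V by (auto simp: T_def less_Suc_eq_le intro!: card_mono)
  qed
  then obtain X where X: "X \<subseteq> T" "scattered (2 * d) X"
    and max: "\<And>Y. Y \<subseteq> T \<Longrightarrow> scattered (2 * d) Y \<Longrightarrow> card Y \<le> card X" by blast
  have finX: "finite X" using X(1) finite_V by (auto simp: T_def intro: finite_subset)
  \<comment> \<open>two elements of \<open>X\<close> with the same anchor would be at distance at most \<open>2 * d\<close>\<close>
  have "inj_on ce X"
  proof (rule inj_onI, rule ccontr)
    fix x y assume xy: "x \<in> X" "y \<in> X" "ce x = ce y" "x \<noteq> y"
    then have "(ce x, x) \<in> S ^^ d" "(ce x, y) \<in> S ^^ d" using cl[of x] cl[of y] X(1) by auto
    from relpow_trans[OF near_sym[OF this(1)] this(2)] xy X(2) show False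
      by (auto simp: scattered_def mult_2)
  qed
  then have "card X = card (ce ` X)" by (simp add: card_image)
  also have "\<dots> \<le> card (Range (\<Union>Q))"
  proof (rule card_mono)
    show "finite (Range (\<Union>Q))" using fin by (rule finite_Range)
    show "ce ` X \<subseteq> Range (\<Union>Q)" using cl X(1) by blast
  qed
  also have "\<dots> \<le> card (\<Union>Q)" unfolding Range_snd using fin by (rule card_image_le)
  also have "\<dots> \<le> M" using Q by (simp add: clusters_def)
  finally have cardX: "card X \<le> M" .
  have "\<exists>g. (\<forall>x\<in>{x \<in> X. cl x = q}. g x \<in> (S ^^ d) `` Domain q) \<and>
      local_game E S P (level M n + 2 * d) (q \<union> (\<lambda>x. (g x, x)) ` {x \<in> X. cl x = q})"
    if q: "q \<in> Q" for q
  proof (rule local_game_reach_set)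
    have "card {x \<in> X. cl x = q} \<le> M"
      using cardX card_mono[OF finX, of "{x \<in> X. cl x = q}"] by auto
    then have "card {x \<in> X. cl x = q} * d \<le> M * d" by (rule mult_le_mono1)
    moreover have "level M (Suc n) = level M n + M * d + 5 * d" by (simp add: d_def algebra_simps)
    ultimately have "level M n + 2 * d + card {x \<in> X. cl x = q} * d \<le> level M (Suc n)"
      by linarith
    moreover have "local_game E S P (level M (Suc n)) q" using Q q by (simp add: clusters_def)
    ultimately show "local_game E S P (level M n + 2 * d + card {x \<in> X. cl x = q} * d) q"
      by (rule local_game_antimono[rotated])
    show "{x \<in> X. cl x = q} \<subseteq> (S ^^ d) `` Range q" using cl X(1) by blast
  qed (use finX in auto)
  then have "\<forall>q\<in>Q. \<exists>g. (\<forall>x\<in>{x \<in> X. cl x = q}. g x \<in> (S ^^ d) `` Domain q) \<and>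
      local_game E S P (level M n + 2 * d) (q \<union> (\<lambda>x. (g x, x)) ` {x \<in> X. cl x = q})"
    by (intro ballI)
  from bchoice[OF this] obtain G where
    "\<forall>q\<in>Q. (\<forall>x\<in>{x \<in> X. cl x = q}. G q x \<in> (S ^^ d) `` Domain q) \<and>
      local_game E S P (level M n + 2 * d) (q \<union> (\<lambda>x. (G q x, x)) ` {x \<in> X. cl x = q})" by (rule exE)
  then have G: "\<And>q x. q \<in> Q \<Longrightarrow> x \<in> X \<Longrightarrow> cl x = q \<Longrightarrow> G q x \<in> (S ^^ d) `` Domain q"
    "\<And>q. q \<in> Q \<Longrightarrow> local_game E S P (level M n + 2 * d) (q \<union> (\<lambda>x. (G q x, x)) ` {x \<in> X. cl x = q})"
    by simp_all
  \<comment> \<open>the copies of the pieces of \<open>X\<close>, put together\<close>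
  define h where "h x = G (cl x) x" for x
  have clX: "cl x \<in> Q" if "x \<in> X" for x using that cl X(1) by blast
  have anchor: "\<exists>a b. (a, b) \<in> cl x \<and> (a, h x) \<in> S ^^ d" if "x \<in> X" for x
    using G(1)[OF clX[OF that] that refl] by (auto simp: h_def)
  have hV: "h x \<in> V" if x: "x \<in> X" for x
  proof -
    obtain a b where "(a, b) \<in> cl x" "(a, h x) \<in> S ^^ d" using anchor[OF x] by blast
    then show ?thesis using near_in_V[of a "h x" d] sub clX[OF x] by auto
  qed
  have hT: "h x \<in> T" if x: "x \<in> X" for x
  proof -
    have "local_game E S P (level M n) {(h x, x)}"
      using local_game_subset[OF local_game_antimono[OF G(2)[OF clX[OF x]], of "level M n"], of "{(h x, x)}"] x
      by (simp add: h_def)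
    from local_game_converse[OF this] have "local_game E S P (level M n) {(x, h x)}"
      by (simp add: converse_insert_pair)
    moreover have "local_game E S P (level M n) {(w, x)}" using x X(1) by (auto simp: T_def)
    ultimately have "local_game E S P (level M n) ({(w, x)} O {(x, h x)})"
      by (intro local_game_relcomp)
    then have "local_game E S P (level M n) {(w, h x)}"
      by (rule local_game_subset) auto
    then show ?thesis using hV[OF x] by (simp add: T_def)
  qed
  have apart: "(h x, h y) \<notin> S ^^ (2 * d)" if xy: "x \<in> X" "y \<in> X" "x \<noteq> y" for x y
  proof (cases "cl x = cl y")
    case True
    let ?p = "cl x \<union> (\<lambda>z. (G (cl x) z, z)) ` {z \<in> X. cl z = cl x}"
    have "local_game E S P (2 * d) ?p"
      using G(2)[OF clX[OF xy(1)]] by (rule local_game_antimono) simp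
    moreover have "(h x, x) \<in> ?p" "(h y, y) \<in> ?p" using xy True by (auto simp: h_def)
    ultimately have "(h x, h y) \<in> S ^^ (2 * d) \<longleftrightarrow> (x, y) \<in> S ^^ (2 * d)"
      by (rule local_game_pair_distance)
    then show ?thesis using X(2) xy by (auto simp: scattered_def)
  next
    case False
    show ?thesis
    proof
      assume near: "(h x, h y) \<in> S ^^ (2 * d)"
      obtain a b where a: "(a, b) \<in> cl x" "(a, h x) \<in> S ^^ d" using anchor xy by blast
      obtain a' b' where a': "(a', b') \<in> cl y" "(a', h y) \<in> S ^^ d" using anchor xy by blast
      from relpow_trans[OF relpow_trans[OF a(2) near] near_sym[OF a'(2)]]
      have "(a, a') \<in> S ^^ (4 ^ Suc n)" by (simp add: d_def)
      moreover have "far_apart (4 ^ Suc n) (cl x) (cl y)"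
        using Q False clX xy by (simp add: clusters_def)
      ultimately show False using a a' unfolding far_apart_def by blast
    qed
  qed
  have w_far: "(w, h x) \<notin> S ^^ (2 * d)" if x: "x \<in> X" for x
  proof
    assume near: "(w, h x) \<in> S ^^ (2 * d)"
    obtain a b where a: "(a, b) \<in> cl x" "(a, h x) \<in> S ^^ d" using anchor x by blast
    from relpow_trans[OF a(2) near_sym[OF near]] have "(a, w) \<in> S ^^ (3 * 4 ^ n)"
      by (simp add: d_def)
    with far[OF clX[OF x] a(1)] show False by simp
  qed
  have wT: "w \<in> T" using w by (simp add: T_def local_game_Id)
  have "scattered (2 * d) (insert w (h ` X))"
    unfolding scattered_def
  proof (intro ballI impI)
    fix y z assume "y \<in> insert w (h ` X)" "z \<in> insert w (h ` X)" "y \<noteq> z"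
    then consider x where "x \<in> X" "y = w" "z = h x" | x where "x \<in> X" "y = h x" "z = w"
      | x x' where "x \<in> X" "x' \<in> X" "x \<noteq> x'" "y = h x" "z = h x'" by auto
    then show "(y, z) \<notin> S ^^ (2 * d)"
    proof cases
      case 1 then show ?thesis using w_far by simp
    next
      case 2 then show ?thesis using w_far near_sym[of y z] by auto
    next
      case 3 then show ?thesis using apart by simp
    qed
  qed
  moreover have "insert w (h ` X) \<subseteq> T" using hT wT by blast
  ultimately have "card (insert w (h ` X)) \<le> card X" by (rule max[rotated])
  moreover have "w \<notin> h ` X" using w_far near_refl[OF w] by auto
  moreover have "inj_on h X"
  proof (rule inj_onI, rule ccontr)
    fix x y assume "x \<in> X" "y \<in> X" "h x = h y" "x \<noteq> y"
    with apart[of x y] near_refl[OF hV, of x] show False by simp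
  qed
  ultimately show False using finX by (simp add: card_image)
qed

text \<open>If \<open>w\<close> is within \<open>3 * 4 ^ n\<close> of a cluster, the local game of this cluster answers the move. It then
keeps distance \<open>4 ^ n\<close> from the others, as \<open>3 * 4 ^ n + 4 ^ n = 4 ^ Suc n\<close>. Otherwise a far witness is the answer.\<close>

lemma clusters_forth:
  assumes Q: "clusters M (Suc n) Q" and w: "w \<in> V"
  shows "\<exists>w'\<in>V. \<exists>Q'. clusters M n Q' \<and> \<Union>Q' = insert (w, w') (\<Union>Q)"
proof (cases "\<exists>q a b. q \<in> Q \<and> (a, b) \<in> q \<and> (a, w) \<in> S ^^ (3 * 4 ^ n)")
  case True
  then obtain q a b where q: "q \<in> Q" "(a, b) \<in> q" "(a, w) \<in> S ^^ (3 * 4 ^ n)" by blast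
  have sub: "\<Union>Q \<subseteq> V \<times> V" using Q by (simp add: clusters_def)
  have "local_game E S P (level M (Suc n)) q" using Q q by (simp add: clusters_def)
  then have "local_game E S P (level M n + 3 * 4 ^ n) q"
    by (rule local_game_antimono) (simp add: algebra_simps)
  from local_game_reach[OF this q(2,3)] obtain w' where
    w': "(b, w') \<in> S ^^ (3 * 4 ^ n)" "local_game E S P (level M n) (insert (w, w') q)" by blast
  have w'V: "w' \<in> V" using near_in_V[OF w'(1)] q sub by auto
  have far: "(a', w) \<notin> S ^^ (4 ^ n) \<and> (b', w') \<notin> S ^^ (4 ^ n)"
    if q': "q' \<in> Q" "q' \<notin> {q}" "(a', b') \<in> q'" for q' a' b'
  proof -
    have "far_apart (4 ^ Suc n) q' q" using Q q q' by (simp add: clusters_def)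
    then have "(a', a) \<notin> S ^^ (4 ^ Suc n)" "(b', b) \<notin> S ^^ (4 ^ Suc n)"
      using q' q unfolding far_apart_def by auto
    then show ?thesis
      using relpow_trans[OF _ near_sym[OF q(3)], of a' "4 ^ n"]
        relpow_trans[OF _ near_sym[OF w'(1)], of b' "4 ^ n"] by auto
  qed
  from clusters_insert[OF Q, of "{q}" w w' "insert (w, w') q"] q w w'V w'(2) far
  show ?thesis by (intro bexI[of _ w'] exI[of _ "insert (insert (w, w') q) (Q - {q})"]) simp_all
next
  case False
  then have nofar: "(a, w) \<notin> S ^^ (3 * 4 ^ n)" if "q \<in> Q" "(a, b) \<in> q" for q a b
    using that by blast
  obtain w' where w': "w' \<in> V" "local_game E S P (level M n) {(w, w')}"
    and far': "\<And>q a b. q \<in> Q \<Longrightarrow> (a, b) \<in> q \<Longrightarrow> (b, w') \<notin> S ^^ (4 ^ n)"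
    proof -
    have "\<exists>w'\<in>V. local_game E S P (level M n) {(w, w')} \<and>
        (\<forall>q\<in>Q. \<forall>a b. (a, b) \<in> q \<longrightarrow> (b, w') \<notin> S ^^ (4 ^ n))"
      by (rule far_witness[OF Q w]) (rule nofar)
    with that show thesis by blast
  qed
  have sub: "\<Union>Q \<subseteq> V \<times> V" using Q by (simp add: clusters_def)
  have far: "(a, w) \<notin> S ^^ (4 ^ n)" if "q \<in> Q" "(a, b) \<in> q" for q a b
  proof
    assume "(a, w) \<in> S ^^ (4 ^ n)"
    moreover have "a \<in> V" using sub that by auto
    ultimately have "(a, w) \<in> S ^^ (3 * 4 ^ n)" by (rule near_mono) simp
    with nofar[OF that] show False by simp
  qed
  from clusters_insert[OF Q, of "{}" w w' "{(w, w')}"] w w' far far'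
  show ?thesis by (intro bexI[of _ w'] exI[of _ "insert {(w, w')} (Q - {})"]) simp_all
qed

text \<open>Locality: far apart positions that are each won locally are won together, globally.\<close>

theorem clusters_game: "clusters M n Q \<Longrightarrow> game V E S P n (\<Union>Q)"
proof (induction n arbitrary: Q)
  case 0
  then show ?case by (simp add: partial_iso_far)
next
  case (Suc n)
  have forth: "\<exists>w'\<in>V. game V E S P n (insert (w, w') (\<Union>Q))" if "w \<in> V" for w
  proof -
    obtain w' Q' where "w' \<in> V" "clusters M n Q'" "\<Union>Q' = insert (w, w') (\<Union>Q)"
      using clusters_forth[OF Suc.prems \<open>w \<in> V\<close>] by blast
    with Suc.IH[of Q'] show ?thesis by auto
  qed
  have backward: "\<exists>w\<in>V. game V E S P n (insert (w, w') (\<Union>Q))" if "w' \<in> V" for w'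
  proof -
    obtain w Q' where w: "w \<in> V" "clusters M n Q'" "\<Union>Q' = insert (w', w) (\<Union>(converse ` Q))"
      using clusters_forth[OF clusters_converse[OF Suc.prems] \<open>w' \<in> V\<close>] by blast
    then have "game V E S P n (insert (w', w) (\<Union>(converse ` Q)))" using Suc.IH[of Q'] by simp
    from game_converse[OF this] have "game V E S P n (insert (w, w') ((\<Union>(converse ` Q))\<inverse>))"
      by (simp only: converse_insert_pair)
    moreover have "(\<Union>(converse ` Q))\<inverse> = \<Union>Q" by auto
    ultimately show ?thesis using w(1) by auto
  qed
  have "game V E S P n (\<Union>Q)"
  proof (cases "V = {}")
    case True
    have "\<Union>Q \<subseteq> V \<times> V" using Suc.prems by (simp add: clusters_def)
    with True have "\<Union>Q \<subseteq> Id" by (simp only: Sigma_empty1 subset_empty empty_subsetI)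
    then show ?thesis by (rule game_Id)
  next
    case False
    then obtain w where "w \<in> V" by blast
    from forth[OF this] obtain w' where "game V E S P n (insert (w, w') (\<Union>Q))" by blast
    then show ?thesis by (rule game_subset) auto
  qed
  then show ?case using forth backward by (rule game_SucI)
qed

end

context homogeneous_partition
begin

text \<open>A single cluster: the global type of a vertex is determined by its local type. This will bound the
number of types near a vertex.\<close>

corollary local_game_game:
  assumes "local_game E S P (level (Suc n) n) {(u, v)}" "u \<in> V" "v \<in> V"
  shows "game V E S P n {(u, v)}"
  using clusters_game[of "Suc n" n "{{(u, v)}}"] assms by (simp add: clusters_def)

text \<open>Two clusters: for vertices far apart, the types of the two vertices determine the type of the
pair. Two initial pebble pairs and \<open>n\<close> rounds give the bound \<open>n + 2\<close> on the number of pebbles.\<close>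

corollary game_far_pair:
  assumes "game V E S P (level (n + 2) n) {(u, u')}" "game V E S P (level (n + 2) n) {(v, v')}"
    and "u \<in> V" "u' \<in> V" "v \<in> V" "v' \<in> V"
    and far: "(u, v) \<notin> S ^^ (4 ^ n)" "(u', v') \<notin> S ^^ (4 ^ n)"
  shows "game V E S P n {(u, u'), (v, v')}"
proof -
  have far': "(v, u) \<notin> S ^^ (4 ^ n)" "(v', u') \<notin> S ^^ (4 ^ n)"
    using far near_sym by blast+
  have "clusters (n + 2) n {{(u, u')}, {(v, v')}}"
    unfolding clusters_def
  proof (intro conjI ballI impI)
    show "card (\<Union>{{(u, u')}, {(v, v')}}) + n \<le> n + 2"
      by (simp add: card_insert_if)
  next
    fix q assume "q \<in> {{(u, u')}, {(v, v')}}"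
    then show "local_game E S P (level (n + 2) n) q"
      using game_local_game[OF S_subset] assms(1,2) by auto
  next
    fix q q' assume "q \<in> {{(u, u')}, {(v, v')}}" "q' \<in> {{(u, u')}, {(v, v')}}" "q \<noteq> q'"
    then show "far_apart (4 ^ n) q q'"
      using far far' by (auto simp: far_apart_def)
  qed (use assms in auto)
  from clusters_game[OF this] show ?thesis by (simp add: insert_commute)
qed

end

section \<open>First-order formulas and games\<close>

primrec quantifier_rank :: "fo \<Rightarrow> nat" where
  "quantifier_rank (Eq x y) = 0"
| "quantifier_rank (Adj x y) = 0"
| "quantifier_rank (Neg \<phi>) = quantifier_rank \<phi>"
| "quantifier_rank (Conj \<phi> \<psi>) = max (quantifier_rank \<phi>) (quantifier_rank \<psi>)"
| "quantifier_rank (Exists x \<phi>) = Suc (quantifier_rank \<phi>)"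

lemma game_sat:
  assumes "game (verts G) (edges G) S P n p" "quantifier_rank \<phi> \<le> n"
    and "\<And>x. x \<in> fv \<phi> \<Longrightarrow> (s x, s' x) \<in> p"
  shows "sat G s \<phi> \<longleftrightarrow> sat G s' \<phi>"
  using assms
proof (induction \<phi> arbitrary: n p s s')
  case (Eq x y)
  then have "(s x, s' x) \<in> p" "(s y, s' y) \<in> p" by simp_all
  with partial_isoD(2)[OF game_partial_iso[OF Eq.prems(1)]] show ?case by simp
next
  case (Adj x y)
  then have "(s x, s' x) \<in> p" "(s y, s' y) \<in> p" by simp_all
  with partial_isoD(3)[OF game_partial_iso[OF Adj.prems(1)]] show ?case by simp
next
  case (Neg \<phi>)
  from Neg.IH[OF Neg.prems(1), of s s'] Neg.prems show ?case by simp
next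
  case (Conj \<phi> \<psi>)
  from Conj.IH(1)[OF Conj.prems(1), of s s'] Conj.IH(2)[OF Conj.prems(1), of s s'] Conj.prems
  show ?case by simp
next
  case (Exists x \<phi>)
  obtain m where m: "n = Suc m" "quantifier_rank \<phi> \<le> m"
    using Exists.prems(2) by (cases n) auto
  have IH: "sat G (s(x := a)) \<phi> \<longleftrightarrow> sat G (s'(x := a')) \<phi>"
    if "game (verts G) (edges G) S P m (insert (a, a') p)" for a a'
    using that m(2)
  proof (rule Exists.IH)
    fix y assume "y \<in> fv \<phi>"
    then show "((s(x := a)) y, (s'(x := a')) y) \<in> insert (a, a') p"
      using Exists.prems(3)[of y] by auto
  qed
  show ?case
  proof
    assume "sat G s (Exists x \<phi>)"
    then obtain a where a: "a \<in> verts G" "sat G (s(x := a)) \<phi>" by auto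
    from game_forth[OF Exists.prems(1)[unfolded m(1)] a(1)] obtain a' where
      "a' \<in> verts G" "game (verts G) (edges G) S P m (insert (a, a') p)" by (rule bexE)
    with IH a(2) show "sat G s' (Exists x \<phi>)" by auto
  next
    assume "sat G s' (Exists x \<phi>)"
    then obtain a' where a': "a' \<in> verts G" "sat G (s'(x := a')) \<phi>" by auto
    from game_back[OF Exists.prems(1)[unfolded m(1)] a'(1)] obtain a where
      "a \<in> verts G" "game (verts G) (edges G) S P m (insert (a, a') p)" by (rule bexE)
    with IH a'(2) show "sat G s (Exists x \<phi>)" by auto
  qed
qed

lemma game_sat2:
  assumes "game (verts G) (edges G) S P (quantifier_rank \<phi>) {(u, u'), (v, v')}" "fv \<phi> \<subseteq> {0, 1}"
  shows "sat2 G \<phi> u v \<longleftrightarrow> sat2 G \<phi> u' v'"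
  unfolding sat2_def by (rule game_sat[OF assms(1) order_refl]) simp

section \<open>The number of local types\<close>

lemma ex_encoding:
  assumes "finite F"
  shows "\<exists>e. \<exists>B::nat. inj_on e F \<and> e ` F = {..<B}"
proof -
  obtain e :: "'a \<Rightarrow> nat" and B where "e ` F = {i. i < B}" "inj_on e F"
    using finite_imp_inj_to_nat_seg[OF assms] by blast
  then show ?thesis by (auto simp: lessThan_def)
qed

text \<open>A finite code for the isomorphism type of a tuple; the first component of the triples tells apart
equality, adjacency, \<open>S\<close>, and membership in the part numbered by \<open>\<iota>\<close>.\<close>

definition atoms :: "'a set set \<Rightarrow> 'a rel \<Rightarrow> 'a set set \<Rightarrow> ('a set \<Rightarrow> nat) \<Rightarrow> 'a list \<Rightarrow> (nat \<times> nat \<times> nat) set" where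
  "atoms E S P \<iota> xs =
     {(0, i, j) |i j. i < length xs \<and> j < length xs \<and> xs ! i = xs ! j} \<union>
     {(1, i, j) |i j. i < length xs \<and> j < length xs \<and> {xs ! i, xs ! j} \<in> E} \<union>
     {(2, i, j) |i j. i < length xs \<and> j < length xs \<and> (xs ! i, xs ! j) \<in> S} \<union>
     {(3, i, \<iota> A) |i A. i < length xs \<and> A \<in> P \<and> xs ! i \<in> A}"

lemma atoms_partial_iso:
  assumes eq: "atoms E S P \<iota> xs = atoms E S P \<iota> ys" and len: "length xs = length ys"
    and inj: "inj_on \<iota> P"
  shows "partial_iso E S P (set (zip xs ys))"
  unfolding partial_iso_def
proof (intro conjI allI impI)
  fix a b assume "(a, b) \<in> set (zip xs ys)"
  then obtain i where i: "i < length xs" "a = xs ! i" "b = ys ! i" using len by (auto simp: set_zip)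
  have "a \<in> A \<longleftrightarrow> b \<in> A" if A: "A \<in> P" for A
  proof -
    have "(3, i, \<iota> A) \<in> atoms E S P \<iota> xs \<longleftrightarrow> a \<in> A"
      using i A inj by (auto simp: atoms_def dest: inj_onD)
    moreover have "(3, i, \<iota> A) \<in> atoms E S P \<iota> ys \<longleftrightarrow> b \<in> A"
      using i A inj len by (auto simp: atoms_def dest: inj_onD)
    ultimately show ?thesis using eq by simp
  qed
  then show "\<forall>A\<in>P. (a \<in> A) = (b \<in> A)" by simp
  fix a' b' assume "(a', b') \<in> set (zip xs ys)"
  then obtain j where j: "j < length xs" "a' = xs ! j" "b' = ys ! j" using len by (auto simp: set_zip)
  have "(k, i, j) \<in> atoms E S P \<iota> xs \<longleftrightarrow> (k, i, j) \<in> atoms E S P \<iota> ys" for k using eq by simp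
  from this[of 0] this[of 1] this[of 2]
  show "(a = a') = (b = b')" "({a, a'} \<in> E) = ({b, b'} \<in> E)" "((a, a') \<in> S) = ((b, b') \<in> S)"
    using i j len by (simp_all add: atoms_def)
qed

text \<open>The function \<open>c\<close> maps tuples of length \<open>m\<close> to fewer than \<open>B\<close> colours such that tuples of the same
colour are indistinguishable in the local game of length \<open>n\<close>. Only tuples whose neighbourhoods of
radius \<open>n\<close> lie in \<open>X\<close> are considered: no play that starts from them leaves \<open>X\<close>.\<close>

definition local_invariant ::
    "'a set set \<Rightarrow> 'a rel \<Rightarrow> 'a set set \<Rightarrow> 'a set \<Rightarrow> nat \<Rightarrow> nat \<Rightarrow> nat \<Rightarrow> ('a list \<Rightarrow> nat) \<Rightarrow> bool" where
  "local_invariant E S P X n m B c \<longleftrightarrow> (\<forall>xs. length xs = m \<longrightarrow> c xs < B) \<and>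
     (\<forall>xs ys. length xs = m \<longrightarrow> length ys = m \<longrightarrow>
        (\<forall>x\<in>set xs \<union> set ys. \<forall>i\<le>n. (S ^^ i) `` {x} \<subseteq> X) \<longrightarrow> c xs = c ys \<longrightarrow>
        local_game E S P n (set (zip xs ys)))"

text \<open>The bound \<open>B\<close> depends only on the length of the game, the number of pebbles, and the number \<open>K\<close> of parts that
\<open>X\<close> meets. The colour of a tuple for \<open>n + 1\<close> rounds is the set of colours, for \<open>n\<close> rounds, of the
tuples to which a local move can lead; for \<open>0\<close> rounds it is the isomorphism type of the tuple, where the
number of unary predicates that hold somewhere in \<open>X\<close> is at most \<open>K\<close>.\<close>

lemma bounded_local_types:
  assumes "m > 0"
  shows "\<exists>B::nat. \<forall>E S P (X :: 'a set).
     finite {A \<in> P. A \<inter> X \<noteq> {}} \<longrightarrow> card {A \<in> P. A \<inter> X \<noteq> {}} \<le> K \<longrightarrow> (\<forall>x\<in>X. (x, x) \<in> S) \<longrightarrow>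
     (\<exists>c. local_invariant E S P X n m B c)"
  using assms
proof (induction n arbitrary: m)
  case 0
  define F where "F = Pow ({..<4::nat} \<times> {..<m} \<times> {..<m + K})"
  have "finite F" by (simp add: F_def)
  from ex_encoding[OF this] obtain e and B :: nat where e: "inj_on e F" "e ` F = {..<B}" by blast
  show ?case
  proof (intro exI[of _ B] allI impI)
    fix E S P and X :: "'a set"
    let ?P = "{A \<in> P. A \<inter> X \<noteq> {}}"
    assume fin: "finite ?P" and K: "card ?P \<le> K"
    obtain \<iota> where \<iota>: "inj_on \<iota> ?P" "\<iota> ` ?P \<subseteq> {..<K}"
    proof -
      obtain \<iota> where "bij_betw \<iota> ?P {0..<card ?P}" using ex_bij_betw_finite_nat[OF fin] by blast
      then show thesis using that[of \<iota>] K by (auto simp: bij_betw_def atLeast0LessThan)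
    qed
    have atF: "atoms E S ?P \<iota> xs \<in> F" if "length xs = m" for xs
      using that \<iota>(2) by (fastforce simp: atoms_def F_def)
    show "\<exists>c. local_invariant E S P X 0 m B c"
      unfolding local_invariant_def
    proof (intro exI[of _ "\<lambda>xs. e (atoms E S ?P \<iota> xs)"] conjI allI impI)
      fix xs :: "'a list" assume "length xs = m"
      then show "e (atoms E S ?P \<iota> xs) < B" using atF e(2) by auto
    next
      fix xs ys :: "'a list" assume len: "length xs = m" "length ys = m"
        and inside: "\<forall>x\<in>set xs \<union> set ys. \<forall>i\<le>0. (S ^^ i) `` {x} \<subseteq> X"
        and "e (atoms E S ?P \<iota> xs) = e (atoms E S ?P \<iota> ys)"
      then have "atoms E S ?P \<iota> xs = atoms E S ?P \<iota> ys" using atF e(1) by (auto dest: inj_onD)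
      from atoms_partial_iso[OF this _ \<iota>(1)] len
      have iso: "partial_iso E S ?P (set (zip xs ys))" by simp
      have "partial_iso E S P (set (zip xs ys))"
        unfolding partial_iso_def
      proof (intro conjI allI impI)
        fix a b assume ab: "(a, b) \<in> set (zip xs ys)"
        then have "a \<in> X" "b \<in> X" using inside by (auto dest: set_zip_leftD set_zip_rightD)
        with partial_isoD(1)[OF iso ab] show "\<forall>A\<in>P. (a \<in> A) = (b \<in> A)" by blast
        fix a' b' assume "(a', b') \<in> set (zip xs ys)"
        from partial_isoD(2-)[OF iso ab this]
        show "(a = a') = (b = b')" "({a, a'} \<in> E) = ({b, b'} \<in> E)" "((a, a') \<in> S) = ((b, b') \<in> S)" .
      qed
      then show "local_game E S P 0 (set (zip xs ys))" by simp
    qed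
  qed
next
  case (Suc n)
  obtain B :: nat where B: "\<And>E S P (X :: 'a set).
     finite {A \<in> P. A \<inter> X \<noteq> {}} \<Longrightarrow> card {A \<in> P. A \<inter> X \<noteq> {}} \<le> K \<Longrightarrow> (\<forall>x\<in>X. (x, x) \<in> S) \<Longrightarrow>
     (\<exists>c. local_invariant E S P X n (Suc m) B c)"
    using Suc.IH[of "Suc m"] by auto
  have "finite (Pow {..<B})" by simp
  from ex_encoding[OF this] obtain e and B' :: nat where e: "inj_on e (Pow {..<B})" "e ` (Pow {..<B}) = {..<B'}"
    by blast
  show ?case
  proof (intro exI[of _ B'] allI impI)
    fix E S P and X :: "'a set"
    assume "finite {A \<in> P. A \<inter> X \<noteq> {}}" "card {A \<in> P. A \<inter> X \<noteq> {}} \<le> K"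
      and refl: "\<forall>x\<in>X. (x, x) \<in> S"
    from B[OF this] obtain c where c: "local_invariant E S P X n (Suc m) B c" by (rule exE)
    define C where "C xs = (\<lambda>w. c (w # xs)) ` (S `` set xs)" for xs
    have CB: "C xs \<in> Pow {..<B}" if "length xs = m" for xs
      using c that by (auto simp: C_def local_invariant_def)
    show "\<exists>c. local_invariant E S P X (Suc n) m B' c"
      unfolding local_invariant_def
    proof (intro exI[of _ "\<lambda>xs. e (C xs)"] conjI allI impI)
      fix xs :: "'a list" assume "length xs = m"
      from imageI[OF CB[OF this], of e] show "e (C xs) < B'" unfolding e(2) by simp
    next
      fix xs ys :: "'a list" assume len: "length xs = m" "length ys = m"
        and inside: "\<forall>x\<in>set xs \<union> set ys. \<forall>i\<le>Suc n. (S ^^ i) `` {x} \<subseteq> X"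
        and "e (C xs) = e (C ys)"
      then have CC: "C xs = C ys" using inj_onD[OF e(1) _ CB CB] by blast
      \<comment> \<open>a move costs one round and one unit of the radius\<close>
      have inside': "(S ^^ i) `` {w} \<subseteq> X" if "w \<in> S `` (set xs \<union> set ys)" "i \<le> n" for w i
      proof -
        obtain x where x: "x \<in> set xs \<union> set ys" "(x, w) \<in> S" using \<open>w \<in> _\<close> by blast
        have "(S ^^ i) `` {w} \<subseteq> (S ^^ Suc i) `` {x}" using relpow_Suc_I2[OF x(2)] by blast
        also have "\<dots> \<subseteq> X" using bspec[OF inside x(1)] \<open>i \<le> n\<close> Suc_le_mono by blast
        finally show ?thesis .
      qed
      have step: "local_game E S P n (insert (w, w') (set (zip xs ys)))"
        if "w \<in> S `` set xs" "w' \<in> S `` set ys" "c (w # xs) = c (w' # ys)" for w w'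
      proof -
        have "w \<in> S `` (set xs \<union> set ys)" "w' \<in> S `` (set xs \<union> set ys)"
          using that(1,2) unfolding Image_Un by simp_all
        with inside inside' have "\<forall>x\<in>set (w # xs) \<union> set (w' # ys). \<forall>i\<le>n. (S ^^ i) `` {x} \<subseteq> X"
          by (simp del: Image_Un)
        moreover have "length (w # xs) = Suc m" "length (w' # ys) = Suc m" using len by simp_all
        ultimately have "local_game E S P n (set (zip (w # xs) (w' # ys)))"
          using c that(3) unfolding local_invariant_def by (iprover elim: conjE dest: spec mp)
        then show ?thesis by simp
      qed
      have forth: "\<exists>w'\<in>S `` set ys. local_game E S P n (insert (w, w') (set (zip xs ys)))"
        if w: "w \<in> S `` set xs" for w
      proof -
        have "c (w # xs) \<in> C xs" using w unfolding C_def by (rule imageI)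
        with CC have "c (w # xs) \<in> C ys" by simp
        then obtain w' where "w' \<in> S `` set ys" "c (w # xs) = c (w' # ys)" unfolding C_def by blast
        from step[OF w this] this(1) show ?thesis by (rule bexI)
      qed
      have backward: "\<exists>w\<in>S `` set xs. local_game E S P n (insert (w, w') (set (zip xs ys)))"
        if w: "w' \<in> S `` set ys" for w'
      proof -
        have "c (w' # ys) \<in> C ys" using w unfolding C_def by (rule imageI)
        with CC have "c (w' # ys) \<in> C xs" by simp
        then obtain w where w': "w \<in> S `` set xs" "c (w' # ys) = c (w # xs)" unfolding C_def by blast
        from step[OF w'(1) w w'(2)[symmetric]] w'(1) show ?thesis by (rule bexI)
      qed
      show "local_game E S P (Suc n) (set (zip xs ys))"
      proof (rule local_game_SucI)
        obtain x where x: "x \<in> set xs" using len \<open>0 < m\<close> by (cases xs) auto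
        have "(S ^^ 0) `` {x} \<subseteq> X" using inside x by blast
        with refl have "(x, x) \<in> S" by auto
        from ImageI[OF this x] have "x \<in> S `` set xs" .
        from forth[OF this] obtain w' where "local_game E S P n (insert (x, w') (set (zip xs ys)))" by (rule bexE)
        then show "local_game E S P n (set (zip xs ys))" by (rule local_game_subset) (rule subset_insertI)
      next
        fix a b w assume ab: "(a, b) \<in> set (zip xs ys)" "(a, w) \<in> S"
        then have "w \<in> S `` set xs" by (auto dest: set_zip_leftD)
        from forth[OF this] obtain w' where w': "local_game E S P n (insert (w, w') (set (zip xs ys)))" by (rule bexE)
        with partial_isoD(4)[OF local_game_partial_iso[OF w'], of a b w w'] ab have "(b, w') \<in> S" by simp
        with w' show "\<exists>w'. (b, w') \<in> S \<and> local_game E S P n (insert (w, w') (set (zip xs ys)))" by (intro exI conjI)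
      next
        fix a b w' assume ab: "(a, b) \<in> set (zip xs ys)" "(b, w') \<in> S"
        then have "w' \<in> S `` set ys" by (auto dest: set_zip_rightD)
        from backward[OF this] obtain w where w: "local_game E S P n (insert (w, w') (set (zip xs ys)))" by (rule bexE)
        with partial_isoD(4)[OF local_game_partial_iso[OF w], of a b w w'] ab have "(a, w) \<in> S" by simp
        with w show "\<exists>w. (a, w) \<in> S \<and> local_game E S P n (insert (w, w') (set (zip xs ys)))" by (intro exI conjI)
      qed
    qed
  qed
qed

section \<open>States of a construction sequence\<close>

text \<open>What a state of a construction sequence of the graph with edge set \<open>E\<close> has to satisfy so that the
sequence can still be completed. The last conjunct is the homogeneity of unresolved pairs. The notion is
used for the given sequence of \<open>G\<close> and for the new one of \<open>\<phi>(G)\<close>.\<close>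

definition consistent :: "'a set \<Rightarrow> 'a set set \<Rightarrow> 'a cstate \<Rightarrow> bool" where
  "consistent V E s \<longleftrightarrow> partition_on V (parts s) \<and> E \<subseteq> [V]\<^bsup>2\<^esup> \<and>
     pos s \<subseteq> E \<and> neg s \<subseteq> [V]\<^bsup>2\<^esup> - E \<and> unres s = [V]\<^bsup>2\<^esup> - (pos s \<union> neg s) \<and>
     (\<forall>A\<in>parts s. \<forall>B\<in>parts s. \<forall>e\<in>unres s \<inter> pairs_between A B. \<forall>e'\<in>unres s \<inter> pairs_between A B.
        e \<in> E \<longleftrightarrow> e' \<in> E)"

text \<open>The share of \<open>consistent\<close> that construction steps preserve forwards. The rest depends on the final
graph and is propagated backwards from the final state.\<close>

definition well_formed :: "'a set \<Rightarrow> 'a cstate \<Rightarrow> bool" where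
  "well_formed V s \<longleftrightarrow> partition_on V (parts s) \<and> pos s \<inter> neg s = {} \<and>
     pos s \<union> neg s \<subseteq> [V]\<^bsup>2\<^esup> \<and> unres s = [V]\<^bsup>2\<^esup> - (pos s \<union> neg s)"

lemma consistentD:
  assumes "consistent V E s"
  shows "partition_on V (parts s)" "E \<subseteq> [V]\<^bsup>2\<^esup>" "pos s \<subseteq> E" "neg s \<subseteq> [V]\<^bsup>2\<^esup> - E"
    "unres s = [V]\<^bsup>2\<^esup> - (pos s \<union> neg s)"
    "A \<in> parts s \<Longrightarrow> B \<in> parts s \<Longrightarrow> e \<in> unres s \<Longrightarrow> e \<in> pairs_between A B \<Longrightarrow>
       e' \<in> unres s \<Longrightarrow> e' \<in> pairs_between A B \<Longrightarrow> e \<in> E \<longleftrightarrow> e' \<in> E"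
  using assms unfolding consistent_def by blast+

definition resolved_near :: "'a set \<Rightarrow> 'a cstate \<Rightarrow> 'a rel" where
  "resolved_near V s = {(a, b) \<in> V \<times> V. a = b \<or> {a, b} \<in> pos s \<union> neg s}"

lemma pairs_between_iff: "{a, b} \<in> pairs_between A B \<longleftrightarrow> a \<in> A \<and> b \<in> B \<or> a \<in> B \<and> b \<in> A"
  by (auto simp: pairs_between_def doubleton_eq_iff)

lemma pairs_between_mono: "A \<subseteq> A' \<Longrightarrow> B \<subseteq> B' \<Longrightarrow> pairs_between A B \<subseteq> pairs_between A' B'"
  unfolding pairs_between_def by blast

lemma resolved_near_sub: "resolved_near V s \<subseteq> V \<times> V"
  by (auto simp: resolved_near_def)

lemma resolved_near_refl: "refl_on V (resolved_near V s)"
  by (auto simp: refl_on_def resolved_near_def)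

lemma resolved_near_sym: "sym (resolved_near V s)"
  by (auto simp: sym_def resolved_near_def insert_commute)

lemma partition_on_part_unique:
  "partition_on V P \<Longrightarrow> A \<in> P \<Longrightarrow> B \<in> P \<Longrightarrow> x \<in> A \<Longrightarrow> x \<in> B \<Longrightarrow> A = B"
  unfolding partition_on_def disjoint_def by blast

lemma partition_on_part_ex: "partition_on V P \<Longrightarrow> x \<in> V \<Longrightarrow> \<exists>A\<in>P. x \<in> A"
  unfolding partition_on_def by blast

lemma consistent_homogeneous_partition:
  assumes "finite V" "consistent V E s"
  shows "homogeneous_partition V E (resolved_near V s) (parts s)"
proof
  show "finite V" by fact
  show "resolved_near V s \<subseteq> V \<times> V" by (rule resolved_near_sub)
  show "refl_on V (resolved_near V s)" by (rule resolved_near_refl)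
  show "sym (resolved_near V s)" by (rule resolved_near_sym)
  show V: "\<Union>(parts s) = V" using consistentD(1)[OF assms(2)] by (simp add: partition_on_def)
  fix A B a a' b b' assume AB: "A \<in> parts s" "B \<in> parts s" "a \<in> A" "a' \<in> A" "b \<in> B" "b' \<in> B"
    and far: "(a, b) \<notin> resolved_near V s" "(a', b') \<notin> resolved_near V s"
  have unres: "{a, b} \<in> unres s" "{a', b'} \<in> unres s"
    using AB V far unfolding consistentD(5)[OF assms(2)] resolved_near_def by auto
  have "{a, b} \<in> pairs_between A B" "{a', b'} \<in> pairs_between A B"
    using AB by (simp_all add: pairs_between_iff)
  from consistentD(6)[OF assms(2) AB(1,2) unres(1) this(1) unres(2) this(2)]
  show "{a, b} \<in> E \<longleftrightarrow> {a', b'} \<in> E" .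
qed

lemma merge_partition_on:
  assumes P: "partition_on V P" and AB: "A \<in> P" "B \<in> P"
  shows "partition_on V (insert (A \<union> B) (P - {A, B}))"
proof (rule partition_onI)
  show "\<Union>(insert (A \<union> B) (P - {A, B})) = V" using P AB by (auto simp: partition_on_def)
  show "{} \<notin> insert (A \<union> B) (P - {A, B})"
    using P AB by (auto simp: partition_on_def)
  show "disjnt p q" if "p \<in> insert (A \<union> B) (P - {A, B})" "q \<in> insert (A \<union> B) (P - {A, B})" "p \<noteq> q" for p q
    using that partition_on_part_unique[OF P] AB unfolding disjnt_iff by blast
qed

lemma refines_merge:
  assumes P: "partition_on V P" and AB: "A \<in> P" "B \<in> P"
  shows "refines V P (insert (A \<union> B) (P - {A, B}))"
  unfolding refines_def
proof (intro conjI ballI P merge_partition_on AB)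
  fix C assume "C \<in> P"
  then show "\<exists>D\<in>insert (A \<union> B) (P - {A, B}). C \<subseteq> D" by (cases "C \<in> {A, B}") auto
qed

lemma cstep_well_formed:
  assumes "cstep s s'" "well_formed V s"
  shows "well_formed V s'"
  using assms by cases (auto simp: well_formed_def merge_partition_on)

lemma cstep_resolved_mono:
  assumes "cstep s s'"
  shows "pos s \<subseteq> pos s'" "neg s \<subseteq> neg s'"
  using assms by (cases, auto)+

lemma resolved_near_mono:
  "pos s \<union> neg s \<subseteq> pos s' \<union> neg s' \<Longrightarrow> resolved_near V s \<subseteq> resolved_near V s'"
  by (auto simp: resolved_near_def)

lemma pairs_between_unique:
  assumes P: "partition_on V P" and parts: "A \<in> P" "B \<in> P" "C \<in> P" "D \<in> P"
    and e: "e \<in> pairs_between A B" "e \<in> pairs_between C D"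
  shows "{C, D} = {A, B}"
proof -
  obtain a b where ab: "e = {a, b}" "a \<in> A" "b \<in> B" using e(1) unfolding pairs_between_def by blast
  with e(2) consider "a \<in> C" "b \<in> D" | "a \<in> D" "b \<in> C" by (auto simp: pairs_between_iff)
  then show ?thesis
  proof cases
    case 1
    with ab parts have "A = C" "B = D" by (simp_all add: partition_on_part_unique[OF P])
    then show ?thesis by simp
  next
    case 2
    with ab parts have "A = D" "B = C" by (simp_all add: partition_on_part_unique[OF P])
    then show ?thesis by auto
  qed
qed

text \<open>Parts only grow, so two pairs that are unresolved between the same two parts stay so until
one operation resolves both of them.\<close>

lemma cstep_consistent_backwards:
  assumes step: "cstep s s'" and s: "well_formed V s" and s': "consistent V E s'"
  shows "consistent V E s"
proof -
  have P: "partition_on V (parts s)" using s by (simp add: well_formed_def)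
  note disj = pairs_between_unique[OF P]
  have comm: "pairs_between B A = pairs_between A B" for A B :: "'a set"
    unfolding pairs_between_def by (auto simp: insert_commute)
  have mono: "pos s \<subseteq> E" "neg s \<subseteq> [V]\<^bsup>2\<^esup> - E" "E \<subseteq> [V]\<^bsup>2\<^esup>"
    using cstep_resolved_mono[OF step] consistentD(2-4)[OF s'] by auto
  have hom: "e \<in> E \<longleftrightarrow> e' \<in> E" if CD: "C \<in> parts s" "D \<in> parts s" and e: "e \<in> unres s" "e \<in> pairs_between C D"
    and e': "e' \<in> unres s" "e' \<in> pairs_between C D" for C D e e'
    using step
  proof cases
    case (merge A B)
    obtain C' where C': "C' \<in> parts s'" "C \<subseteq> C'" using merge CD by (cases "C \<in> {A, B}") auto
    obtain D' where D': "D' \<in> parts s'" "D \<subseteq> D'" using merge CD by (cases "D \<in> {A, B}") auto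
    have "unres s' = unres s" using merge by simp
    with e e' pairs_between_mono[OF C'(2) D'(2)]
    have "e \<in> unres s'" "e \<in> pairs_between C' D'" "e' \<in> unres s'" "e' \<in> pairs_between C' D'"
      by auto
    then show ?thesis by (rule consistentD(6)[OF s' C'(1) D'(1)])
  next
    case (resolve_pos A B)
    show ?thesis
    proof (cases "{C, D} = {A, B}")
      case True
      then have "pairs_between C D = pairs_between A B" using comm by (auto simp: doubleton_eq_iff)
      then have "e \<in> pos s'" "e' \<in> pos s'" using resolve_pos e e' by simp_all
      then show ?thesis using consistentD(3)[OF s'] by blast
    next
      case False
      then have "x \<notin> pairs_between A B" if "x \<in> pairs_between C D" for x
        using disj[OF resolve_pos(2,3) CD _ that] by blast
      with e e' have "e \<in> unres s'" "e' \<in> unres s'" using resolve_pos(1) by simp_all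
      moreover have "C \<in> parts s'" "D \<in> parts s'" using resolve_pos CD by simp_all
      ultimately show ?thesis using consistentD(6)[OF s' _ _ _ e(2) _ e'(2)] by simp
    qed
  next
    case (resolve_neg A B)
    show ?thesis
    proof (cases "{C, D} = {A, B}")
      case True
      then have "pairs_between C D = pairs_between A B" using comm by (auto simp: doubleton_eq_iff)
      then have "e \<in> neg s'" "e' \<in> neg s'" using resolve_neg e e' by simp_all
      then show ?thesis using consistentD(4)[OF s'] by blast
    next
      case False
      then have "x \<notin> pairs_between A B" if "x \<in> pairs_between C D" for x
        using disj[OF resolve_neg(2,3) CD _ that] by blast
      with e e' have "e \<in> unres s'" "e' \<in> unres s'" using resolve_neg(1) by simp_all
      moreover have "C \<in> parts s'" "D \<in> parts s'" using resolve_neg CD by simp_all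
      ultimately show ?thesis using consistentD(6)[OF s' _ _ _ e(2) _ e'(2)] by simp
    qed
  qed
  show ?thesis unfolding consistent_def
    using P mono hom s by (simp add: well_formed_def)
qed

lemma resolved_near_resolve:
  assumes "unres s = [V]\<^bsup>2\<^esup> - (pos s \<union> neg s)"
    and "pos s' \<union> neg s' = pos s \<union> neg s \<union> (unres s \<inter> pairs_between A B)"
  shows "resolved_near V s' =
    resolved_near V s \<union> {(a, b) \<in> V \<times> V. a \<in> A \<and> b \<in> B \<or> a \<in> B \<and> b \<in> A}"
  unfolding resolved_near_def assms by (auto simp: pairs_between_iff)

text \<open>The structure after a step is definable without quantifiers from the structure before it: merging
replaces two unary predicates by their disjunction, and resolving \<open>A\<close> and \<open>B\<close> extends \<open>S\<close> by all pairs
between \<open>A\<close> and \<open>B\<close>.\<close>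

lemma cstep_partial_iso:
  assumes step: "cstep s s'" and s: "well_formed V s"
    and p: "p \<subseteq> V \<times> V" and iso: "partial_iso E (resolved_near V s) (parts s) p"
  shows "partial_iso E (resolved_near V s') (parts s') p"
proof -
  have res: "partial_iso E (resolved_near V s') (parts s) p"
    if AB: "A \<in> parts s" "B \<in> parts s"
      and s': "pos s' \<union> neg s' = pos s \<union> neg s \<union> (unres s \<inter> pairs_between A B)" for A B
    unfolding partial_iso_def
  proof (intro conjI allI impI)
    fix a b assume ab: "(a, b) \<in> p"
    note D = partial_isoD[OF iso ab]
    show "\<forall>A\<in>parts s. (a \<in> A) = (b \<in> A)" using D(1) by simp
    fix a' b' assume ab': "(a', b') \<in> p"
    show "(a = a') = (b = b')" "({a, a'} \<in> E) = ({b, b'} \<in> E)" using D(2,3)[OF ab'] .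
    have "a \<in> V" "b \<in> V" "a' \<in> V" "b' \<in> V" using ab ab' p by auto
    moreover have "a \<in> A \<longleftrightarrow> b \<in> A" "a \<in> B \<longleftrightarrow> b \<in> B" "a' \<in> A \<longleftrightarrow> b' \<in> A" "a' \<in> B \<longleftrightarrow> b' \<in> B"
      using AB D(1) partial_isoD(1)[OF iso ab'] by simp_all
    moreover have "unres s = [V]\<^bsup>2\<^esup> - (pos s \<union> neg s)" using s by (simp add: well_formed_def)
    ultimately show "((a, a') \<in> resolved_near V s') = ((b, b') \<in> resolved_near V s')"
      using D(4)[OF ab'] by (simp add: resolved_near_resolve[OF _ s'])
  qed
  from step show ?thesis
  proof cases
    case (merge A B)
    then have near: "resolved_near V s' = resolved_near V s" by (simp add: resolved_near_def)
    show ?thesis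
      unfolding partial_iso_def near
    proof (intro conjI allI impI)
      fix a b assume ab: "(a, b) \<in> p"
      note D = partial_isoD[OF iso ab]
      show "\<forall>A\<in>parts s'. (a \<in> A) = (b \<in> A)"
        using merge D(1) by simp
      fix a' b' assume ab': "(a', b') \<in> p"
      show "(a = a') = (b = b')" "({a, a'} \<in> E) = ({b, b'} \<in> E)"
        "((a, a') \<in> resolved_near V s) = ((b, b') \<in> resolved_near V s)" using D(2-4)[OF ab'] .
    qed
  next
    case (resolve_pos A B)
    have "pos s' \<union> neg s' = pos s \<union> neg s \<union> (unres s \<inter> pairs_between A B)"
      unfolding resolve_pos(1) by auto
    from res[OF resolve_pos(2,3) this] show ?thesis using resolve_pos(1) by simp
  next
    case (resolve_neg A B)
    have "pos s' \<union> neg s' = pos s \<union> neg s \<union> (unres s \<inter> pairs_between A B)"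
      unfolding resolve_neg(1) by auto
    from res[OF resolve_neg(2,3) this] show ?thesis using resolve_neg(1) by simp
  qed
qed

abbreviation state_game :: "'a set \<Rightarrow> 'a set set \<Rightarrow> 'a cstate \<Rightarrow> nat \<Rightarrow> 'a rel \<Rightarrow> bool" where
  "state_game V E s \<equiv> game V E (resolved_near V s) (parts s)"

lemma cstep_game:
  assumes step: "cstep s s'" and s: "well_formed V s"
  shows "p \<subseteq> V \<times> V \<Longrightarrow> state_game V E s n p \<Longrightarrow> state_game V E s' n p"
proof (induction n arbitrary: p)
  case 0
  then show ?case using cstep_partial_iso[OF step s] by simp
next
  case (Suc n)
  have ins: "insert (w, w') p \<subseteq> V \<times> V" if "w \<in> V" "w' \<in> V" for w w'
    using that Suc.prems(1) by simp
  show ?case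
  proof (rule game_SucI)
    show "state_game V E s' n p" using Suc by simp
  next
    fix w assume w: "w \<in> V"
    from game_forth[OF Suc.prems(2) w] obtain w' where
      w': "w' \<in> V" "state_game V E s n (insert (w, w') p)" by (rule bexE)
    from Suc.IH[OF ins[OF w w'(1)] w'(2)] w'(1)
    show "\<exists>w'\<in>V. state_game V E s' n (insert (w, w') p)" by (rule bexI)
  next
    fix w' assume w': "w' \<in> V"
    from game_back[OF Suc.prems(2) w'] obtain w where
      w: "w \<in> V" "state_game V E s n (insert (w, w') p)" by (rule bexE)
    from Suc.IH[OF ins[OF w(1) w'] w(2)] w(1)
    show "\<exists>w\<in>V. state_game V E s' n (insert (w, w') p)" by (rule bexI)
  qed
qed

definition type_rel :: "'a set \<Rightarrow> 'a set set \<Rightarrow> nat \<Rightarrow> 'a cstate \<Rightarrow> 'a rel" where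
  "type_rel V E n s = {(u, v) \<in> V \<times> V. state_game V E s n {(u, v)}}"

text \<open>The partition of the new construction sequence that accompanies the state \<open>s\<close>.\<close>

definition types :: "'a set \<Rightarrow> 'a set set \<Rightarrow> nat \<Rightarrow> 'a cstate \<Rightarrow> 'a set set" where
  "types V E n s = V // type_rel V E n s"

lemma equiv_type_rel: "equiv V (type_rel V E n s)"
proof (rule equivI)
  show "type_rel V E n s \<subseteq> V \<times> V" by (auto simp: type_rel_def)
  show "refl_on V (type_rel V E n s)" by (auto simp: refl_on_def type_rel_def game_Id)
  show "sym (type_rel V E n s)"
  proof (rule symI)
    fix u v assume "(u, v) \<in> type_rel V E n s"
    then have "u \<in> V" "v \<in> V" "state_game V E s n {(u, v)}" by (auto simp: type_rel_def)
    with game_converse[OF this(3)] show "(v, u) \<in> type_rel V E n s"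
      by (simp add: type_rel_def converse_insert_pair)
  qed
  show "trans (type_rel V E n s)"
  proof (rule transI)
    fix u v w assume uvw: "(u, v) \<in> type_rel V E n s" "(v, w) \<in> type_rel V E n s"
    then have "state_game V E s n {(u, v)}" "state_game V E s n {(v, w)}" "u \<in> V" "w \<in> V"
      by (auto simp: type_rel_def)
    moreover have "{(u, v)} O {(v, w)} = {(u, w)}" by auto
    ultimately show "(u, w) \<in> type_rel V E n s"
      using game_relcomp[of V E _ _ n "{(u, v)}" "{(v, w)}"] by (simp add: type_rel_def)
  qed
qed

lemma partition_on_types: "partition_on V (types V E n s)"
  unfolding types_def by (rule partition_on_quotient[OF equiv_type_rel])

lemma same_type:
  assumes "A \<in> types V E n s" "u \<in> A" "v \<in> A"
  shows "u \<in> V" "v \<in> V" "state_game V E s n {(u, v)}"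
proof -
  have "(u, v) \<in> type_rel V E n s"
    using quotient_eq_iff[OF equiv_type_rel assms(1)[unfolded types_def] assms(1)[unfolded types_def] assms(2,3)]
    by simp
  then show "u \<in> V" "v \<in> V" "state_game V E s n {(u, v)}" by (auto simp: type_rel_def)
qed

lemma same_typeI:
  assumes "A \<in> types V E n s" "u \<in> A" "v \<in> V" "state_game V E s n {(u, v)}"
  shows "v \<in> A"
proof -
  have "u \<in> V" using same_type[OF assms(1,2,2)] by simp
  with assms(3,4) have "(u, v) \<in> type_rel V E n s" by (simp add: type_rel_def)
  with assms(1,2) show ?thesis unfolding types_def
    by (metis equiv_type_rel in_quotient_imp_closed)
qed

lemma refines_types_step:
  assumes "cstep s s'" "well_formed V s"
  shows "refines V (types V E n s) (types V E n s')"
  unfolding refines_def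
proof (intro conjI ballI partition_on_types)
  fix A assume A: "A \<in> types V E n s"
  then have "A \<noteq> {}" using partition_on_types[of V E n s] by (auto simp: partition_on_def)
  then obtain u where u: "u \<in> A" by blast
  then have uV: "u \<in> V" using same_type[OF A] by blast
  from partition_on_part_ex[OF partition_on_types this]
  obtain B where B: "B \<in> types V E n s'" "u \<in> B" by (rule bexE)
  have "v \<in> B" if v: "v \<in> A" for v
  proof (rule same_typeI[OF B])
    show "v \<in> V" using same_type[OF A u v] by simp
    then show "state_game V E s' n {(u, v)}"
      using cstep_game[OF assms _ same_type(3)[OF A u v]] uV by simp
  qed
  with B(1) show "\<exists>B\<in>types V E n s'. A \<subseteq> B" by blast
qed

section \<open>Construction sequences that resolve lazily\<close>

text \<open>Sequences of construction steps all of whose states satisfy \<open>I\<close>; later \<open>I\<close> bounds the width.\<close>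

definition cpath :: "('a cstate \<Rightarrow> bool) \<Rightarrow> 'a cstate \<Rightarrow> 'a cstate \<Rightarrow> bool" where
  "cpath I = (\<lambda>s s'. cstep s s' \<and> I s \<and> I s')\<^sup>*\<^sup>*"

lemma cpath_refl: "cpath I s s"
  by (simp add: cpath_def)

lemma cpath_trans: "cpath I s s' \<Longrightarrow> cpath I s' s'' \<Longrightarrow> cpath I s s''"
  unfolding cpath_def by (rule rtranclp_trans)

lemma cpath_step: "cpath I s s' \<Longrightarrow> cstep s' s'' \<Longrightarrow> I s' \<Longrightarrow> I s'' \<Longrightarrow> cpath I s s''"
  unfolding cpath_def by (rule rtranclp.rtrancl_into_rtrancl) simp_all

lemma cpath_Cons: "cstep s s' \<Longrightarrow> I s \<Longrightarrow> I s' \<Longrightarrow> cpath I s' s'' \<Longrightarrow> cpath I s s''"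
  unfolding cpath_def by (rule converse_rtranclp_into_rtranclp) simp_all

definition blocks :: "('a set \<times> 'a set) set \<Rightarrow> 'a set set" where
  "blocks F = (\<Union>(A, B)\<in>F. pairs_between A B)"

lemma blocks_iff: "e \<in> blocks F \<longleftrightarrow> (\<exists>A B. (A, B) \<in> F \<and> e \<in> pairs_between A B)"
  by (auto simp: blocks_def)

text \<open>The effect of resolving all pairs of parts in \<open>F\<close>, each with the sign that \<open>E\<close> prescribes.\<close>

definition resolve_blocks :: "'a set set \<Rightarrow> ('a set \<times> 'a set) set \<Rightarrow> 'a cstate \<Rightarrow> 'a cstate" where
  "resolve_blocks E F s = s\<lparr> pos := pos s \<union> (unres s \<inter> blocks F \<inter> E),
     neg := neg s \<union> (unres s \<inter> blocks F - E), unres := unres s - blocks F \<rparr>"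

lemma resolve_blocks_simps [simp]:
  "parts (resolve_blocks E F s) = parts s"
  "pos (resolve_blocks E F s) = pos s \<union> (unres s \<inter> blocks F \<inter> E)"
  "neg (resolve_blocks E F s) = neg s \<union> (unres s \<inter> blocks F - E)"
  "unres (resolve_blocks E F s) = unres s - blocks F"
  by (simp_all add: resolve_blocks_def)

lemma blocks_insert: "blocks (insert (A, B) F) = pairs_between A B \<union> blocks F"
  by (simp add: blocks_def)

lemma resolve_blocks_cpath:
  assumes s: "consistent V E s" and "finite F" "F \<subseteq> parts s \<times> parts s"
    and I: "\<And>F'. F' \<subseteq> F \<Longrightarrow> I (resolve_blocks E F' s)"
  shows "cpath I s (resolve_blocks E F s)"
  using assms(2-)
proof (induction F rule: finite_induct)
  case empty
  have "resolve_blocks E {} s = s" by (simp add: resolve_blocks_def blocks_def)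
  then show ?case by (simp add: cpath_refl)
next
  case (insert AB F)
  obtain A B where AB: "AB = (A, B)" by (rule prod.exhaust)
  have parts: "A \<in> parts s" "B \<in> parts s" using insert.prems(1) AB by auto
  let ?s = "resolve_blocks E F s"
  have step: "cstep ?s (resolve_blocks E (insert (A, B) F) s)"
  proof (cases "unres s \<inter> pairs_between A B \<subseteq> E")
    case True
    have "resolve_blocks E (insert (A, B) F) s =
        ?s\<lparr> pos := pos ?s \<union> (unres ?s \<inter> pairs_between A B), unres := unres ?s - pairs_between A B \<rparr>"
      by (rule cstate.equality) (use True in \<open>auto simp: blocks_insert\<close>)
    moreover have "cstep ?s (?s\<lparr> pos := pos ?s \<union> (unres ?s \<inter> pairs_between A B),
        unres := unres ?s - pairs_between A B \<rparr>)"
      using parts by (intro cstep.resolve_pos) simp_all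
    ultimately show ?thesis by simp
  next
    case False
    then obtain e where e: "e \<in> unres s" "e \<in> pairs_between A B" "e \<notin> E" by blast
    have none: "e' \<notin> E" if "e' \<in> unres s" "e' \<in> pairs_between A B" for e'
      using consistentD(6)[OF s parts e(1,2) that] e(3) by simp
    have "resolve_blocks E (insert (A, B) F) s =
        ?s\<lparr> neg := neg ?s \<union> (unres ?s \<inter> pairs_between A B), unres := unres ?s - pairs_between A B \<rparr>"
      by (rule cstate.equality) (use none in \<open>auto simp: blocks_insert\<close>)
    moreover have "cstep ?s (?s\<lparr> neg := neg ?s \<union> (unres ?s \<inter> pairs_between A B),
        unres := unres ?s - pairs_between A B \<rparr>)"
      using parts by (intro cstep.resolve_neg) simp_all
    ultimately show ?thesis by simp
  qed
  have "cpath I s ?s" using insert.prems by (intro insert.IH) auto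
  from cpath_step[OF this step insert.prems(2) insert.prems(2)] AB show ?case by auto
qed

lemma refines_eq_or_mergeable:
  assumes ref: "refines V Q P" and "Q \<noteq> P"
  shows "\<exists>A\<in>Q. \<exists>B\<in>Q. \<exists>C\<in>P. A \<noteq> B \<and> A \<subseteq> C \<and> B \<subseteq> C"
proof (rule ccontr)
  assume none: "\<not> ?thesis"
  have Q: "partition_on V Q" and P: "partition_on V P" using ref by (auto simp: refines_def)
  have "refines V P Q"
    unfolding refines_def
  proof (intro conjI ballI P Q)
    fix C assume C: "C \<in> P"
    then obtain x where x: "x \<in> C" using partition_onD3[OF P] by fastforce
    have CV: "C \<subseteq> V" using C partition_onD1[OF P] by blast
    have part: "\<exists>A\<in>Q. y \<in> A \<and> A \<subseteq> C" if y: "y \<in> C" for y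
    proof -
      obtain A where A: "A \<in> Q" "y \<in> A" using partition_on_part_ex[OF Q] y CV by blast
      obtain C' where C': "C' \<in> P" "A \<subseteq> C'" using ref A(1) unfolding refines_def by blast
      have "C' = C" using partition_on_part_unique[OF P C'(1) C _ y] C'(2) A(2) by blast
      with A C' show ?thesis by blast
    qed
    obtain A where A: "A \<in> Q" "A \<subseteq> C" using part[OF x] by blast
    have "C \<subseteq> A"
    proof
      fix y assume "y \<in> C"
      then obtain B where B: "B \<in> Q" "y \<in> B" "B \<subseteq> C" using part by blast
      with none A C have "A = B" by blast
      with B show "y \<in> A" by simp
    qed
    with A(1) show "\<exists>A\<in>Q. C \<subseteq> A" by blast
  qed
  with ref have "Q = P" by (rule refines_asym)
  with \<open>Q \<noteq> P\<close> show False ..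
qed

text \<open>A coarser partition is reached by merging two parts at a time that lie in the same target part.\<close>

lemma merge_cpath:
  assumes V: "finite V" and "refines V Q P"
    and I: "\<And>Q'. refines V Q Q' \<Longrightarrow> I (s\<lparr>parts := Q'\<rparr>)"
  shows "cpath I (s\<lparr>parts := Q\<rparr>) (s\<lparr>parts := P\<rparr>)"
  using assms(2-)
proof (induction "card Q" arbitrary: Q rule: less_induct)
  case less
  show ?case
  proof (cases "Q = P")
    case True
    then show ?thesis by (simp add: cpath_refl)
  next
    case False
    from refines_eq_or_mergeable[OF less.prems(1) this] obtain A B C where
      AB: "A \<in> Q" "B \<in> Q" "A \<noteq> B" and C: "C \<in> P" "A \<subseteq> C" "B \<subseteq> C" by blast
    have Q: "partition_on V Q" and P: "partition_on V P" using less.prems(1) by (auto simp: refines_def)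
    let ?Q = "insert (A \<union> B) (Q - {A, B})"
    have ref: "refines V Q ?Q" using Q AB by (intro refines_merge)
    have "refines V ?Q P"
      unfolding refines_def
    proof (intro conjI ballI P merge_partition_on[OF Q] AB)
      fix D assume "D \<in> ?Q"
      then show "\<exists>C\<in>P. D \<subseteq> C"
        using C less.prems(1) by (auto simp: refines_def)
    qed
    moreover have fin: "finite Q" by (rule finite_elements[OF V Q])
    have "card ?Q < card Q"
    proof -
      have "card ?Q \<le> Suc (card (Q - {A, B}))" by (rule card_insert_le_m1) simp_all
      also have "card (Q - {A, B}) = card Q - 2" using AB fin by (simp add: card_Diff_subset)
      moreover have "2 \<le> card Q" using card_mono[OF fin, of "{A, B}"] AB by simp
      ultimately show ?thesis by linarith
    qed
    moreover have "I (s\<lparr>parts := Q'\<rparr>)" if "refines V ?Q Q'" for Q'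
      using refines_trans[OF ref that] by (rule less.prems(2))
    ultimately have path: "cpath I (s\<lparr>parts := ?Q\<rparr>) (s\<lparr>parts := P\<rparr>)" by (intro less.hyps)
    have step: "cstep (s\<lparr>parts := Q\<rparr>) (s\<lparr>parts := ?Q\<rparr>)"
      using cstep.merge[of A "s\<lparr>parts := Q\<rparr>" B] AB by simp
    show ?thesis
      by (rule cpath_Cons[OF step less.prems(2)[OF refines_refl[OF Q]] less.prems(2)[OF ref] path])
  qed
qed

text \<open>A consistent state can be advanced to the coarser partition \<open>P\<close> while resolving only pairs in \<open>R\<close>,
provided that the pairs outside \<open>R\<close> between two parts of \<open>P\<close> agree on \<open>E\<close>. A pair of old parts is
resolved if all its unresolved pairs belong to \<open>R\<close>. Between any other two old parts there is an
unresolved pair outside \<open>R\<close>; it agrees with all their unresolved pairs by consistency, and with the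
representatives of the other blocks within the same two parts of \<open>P\<close> by assumption. Hence the state after merging is
consistent as well.\<close>

lemma lazy_construction:
  assumes V: "finite V" and s: "consistent V E s" and ref: "refines V (parts s) P"
    and R: "pos s \<union> neg s \<subseteq> R"
    and hom: "\<And>A B e e'. A \<in> P \<Longrightarrow> B \<in> P \<Longrightarrow> e \<in> [V]\<^bsup>2\<^esup> - R \<Longrightarrow> e \<in> pairs_between A B \<Longrightarrow>
      e' \<in> [V]\<^bsup>2\<^esup> - R \<Longrightarrow> e' \<in> pairs_between A B \<Longrightarrow> e \<in> E \<longleftrightarrow> e' \<in> E"
    and I: "\<And>x. refines V (parts s) (parts x) \<Longrightarrow> pos x \<union> neg x \<subseteq> R \<Longrightarrow> I x"
  shows "\<exists>s'. cpath I s s' \<and> consistent V E s' \<and> parts s' = P \<and> pos s' \<union> neg s' \<subseteq> R \<and>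
    ([V]\<^bsup>2\<^esup> \<subseteq> R \<longrightarrow> unres s' = {})"
proof -
  note cons = consistentD[OF s]
  have fin: "finite (parts s)" by (rule finite_elements[OF V cons(1)])
  have P: "partition_on V P" using ref by (simp add: refines_def)
  define F where "F = {(A, B) \<in> parts s \<times> parts s. unres s \<inter> pairs_between A B \<subseteq> R}"
  have F_sub: "F \<subseteq> parts s \<times> parts s" by (auto simp: F_def)
  note F = finite_subset[OF F_sub finite_cartesian_product[OF fin fin]] F_sub
  define s1 where "s1 = resolve_blocks E F s"
  define s2 where "s2 = s1\<lparr>parts := P\<rparr>"
  have in_R: "pos (resolve_blocks E F' s) \<union> neg (resolve_blocks E F' s) \<subseteq> R" if "F' \<subseteq> F" for F'
  proof -
    have "unres s \<inter> blocks F' \<subseteq> R"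
    proof
      fix e assume e: "e \<in> unres s \<inter> blocks F'"
      then obtain A B where AB: "(A, B) \<in> F'" "e \<in> pairs_between A B" by (auto simp: blocks_iff)
      then have "unres s \<inter> pairs_between A B \<subseteq> R" using that by (auto simp: F_def)
      with e AB(2) show "e \<in> R" by blast
    qed
    with R show ?thesis by auto
  qed
  have "cpath I s s1"
    unfolding s1_def
  proof (rule resolve_blocks_cpath[OF s F])
    fix F' assume "F' \<subseteq> F"
    from in_R[OF this] show "I (resolve_blocks E F' s)"
      by (intro I) (simp_all add: refines_refl cons(1))
  qed
  moreover have "cpath I (s1\<lparr>parts := parts s\<rparr>) s2"
    unfolding s2_def
  proof (rule merge_cpath[OF V ref])
    fix Q' assume "refines V (parts s) Q'"
    then show "I (s1\<lparr>parts := Q'\<rparr>)" using in_R[of F] by (intro I) (simp_all add: s1_def)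
  qed
  moreover have "s1\<lparr>parts := parts s\<rparr> = s1" by (rule cstate.equality) (simp_all add: s1_def)
  ultimately have "cpath I s s2" using cpath_trans by metis
  moreover have "consistent V E s2"
  proof -
    have witness: "\<exists>e0 \<in> [V]\<^bsup>2\<^esup> - R. e0 \<in> pairs_between A' B' \<and> (e \<in> E \<longleftrightarrow> e0 \<in> E)"
      if A'B': "A' \<in> P" "B' \<in> P" and e: "e \<in> unres s2" "e \<in> pairs_between A' B'" for A' B' e
    proof -
      obtain a b where ab: "e = {a, b}" "a \<in> A'" "b \<in> B'" using e(2) by (auto simp: pairs_between_def)
      have "a \<in> V" "b \<in> V" using ab A'B' P by (auto simp: partition_on_def)
      then obtain A B where A: "A \<in> parts s" "a \<in> A" and B: "B \<in> parts s" "b \<in> B"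
        using partition_on_part_ex[OF cons(1)] by blast
      obtain A'' where A'': "A'' \<in> P" "A \<subseteq> A''" using ref A(1) unfolding refines_def by blast
      obtain B'' where B'': "B'' \<in> P" "B \<subseteq> B''" using ref B(1) unfolding refines_def by blast
      have "A'' = A'" by (rule partition_on_part_unique[OF P A''(1) A'B'(1) _ ab(2)]) (use A A'' in blast)
      moreover have "B'' = B'" by (rule partition_on_part_unique[OF P B''(1) A'B'(2) _ ab(3)]) (use B B'' in blast)
      ultimately have sub: "pairs_between A B \<subseteq> pairs_between A' B'"
        using A''(2) B''(2) by (intro pairs_between_mono) simp_all
      have eAB: "e \<in> pairs_between A B" unfolding ab(1) using A(2) B(2) by (simp add: pairs_between_iff)
      have es: "e \<in> unres s" "e \<notin> blocks F" using e(1) by (simp_all add: s2_def s1_def)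
      then have "(A, B) \<notin> F" using eAB unfolding blocks_iff by blast
      \<comment> \<open>some unresolved pair of this block is outside \<open>R\<close>, as otherwise the block would have been resolved\<close>
      then obtain e0 where e0: "e0 \<in> unres s" "e0 \<in> pairs_between A B" "e0 \<notin> R"
        using A(1) B(1) unfolding F_def by blast
      have "e \<in> E \<longleftrightarrow> e0 \<in> E" by (rule cons(6)[OF A(1) B(1) es(1) eAB e0(1,2)])
      moreover have "e0 \<in> [V]\<^bsup>2\<^esup> - R" using e0(1,3) unfolding cons(5) by simp
      ultimately show ?thesis using e0(2) sub by blast
    qed
    have hom2: "e \<in> E \<longleftrightarrow> e' \<in> E"
      if AB: "A \<in> P" "B \<in> P" and e: "e \<in> unres s2 \<inter> pairs_between A B" "e' \<in> unres s2 \<inter> pairs_between A B"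
      for A B e e'
    proof -
      from witness[OF AB, of e] e obtain e0 where
        e0: "e0 \<in> [V]\<^bsup>2\<^esup> - R" "e0 \<in> pairs_between A B" "e \<in> E \<longleftrightarrow> e0 \<in> E" by auto
      from witness[OF AB, of e'] e obtain e1 where
        e1: "e1 \<in> [V]\<^bsup>2\<^esup> - R" "e1 \<in> pairs_between A B" "e' \<in> E \<longleftrightarrow> e1 \<in> E" by auto
      from hom[OF AB e0(1,2) e1(1,2)] e0(3) e1(3) show ?thesis by simp
    qed
    have "parts s2 = P" by (simp add: s2_def)
    moreover have "pos s2 \<subseteq> E" using cons(3) by (auto simp: s2_def s1_def)
    moreover have "neg s2 \<subseteq> [V]\<^bsup>2\<^esup> - E" using cons(4,5) by (auto simp: s2_def s1_def)
    moreover have "unres s2 = [V]\<^bsup>2\<^esup> - (pos s2 \<union> neg s2)" using cons(5) by (auto simp: s2_def s1_def)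
    moreover have "\<forall>A\<in>P. \<forall>B\<in>P. \<forall>e\<in>unres s2 \<inter> pairs_between A B.
        \<forall>e'\<in>unres s2 \<inter> pairs_between A B. e \<in> E \<longleftrightarrow> e' \<in> E"
      by (intro ballI) (rule hom2)
    ultimately show ?thesis unfolding consistent_def using P cons(2) by blast
  qed
  moreover have "pos s2 \<union> neg s2 \<subseteq> R" using in_R[of F] by (simp add: s2_def s1_def)
  moreover have "unres s2 = {}" if "[V]\<^bsup>2\<^esup> \<subseteq> R"
  proof -
    have "e \<in> blocks F" if e: "e \<in> unres s" for e
    proof -
      have "e \<in> [V]\<^bsup>2\<^esup>" using e unfolding cons(5) by simp
      then obtain a b where ab: "e = {a, b}" "a \<in> V" "b \<in> V" by (rule nsets2_E) auto
      then obtain A B where A: "A \<in> parts s" "a \<in> A" and B: "B \<in> parts s" "b \<in> B"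
        using partition_on_part_ex[OF cons(1)] by blast
      have "(A, B) \<in> F" using A B \<open>[V]\<^bsup>2\<^esup> \<subseteq> R\<close> unfolding F_def cons(5) by auto
      moreover have "e \<in> pairs_between A B" using ab A B by (simp add: pairs_between_iff)
      ultimately show ?thesis unfolding blocks_iff by blast
    qed
    then show ?thesis by (auto simp: s2_def s1_def)
  qed
  ultimately show ?thesis by (intro exI[of _ s2]) (simp add: s2_def)
qed

section \<open>Width of partitions into types\<close>

lemma reachable_near:
  assumes "reachable (resolved_graph V s) r v w" "v \<in> V"
  shows "(v, w) \<in> resolved_near V s ^^ r"
proof -
  let ?S = "resolved_near V s"
  obtain p where p: "is_path (resolved_graph V s) p" "hd p = v" "last p = w" "length p - 1 \<le> r"
    using assms(1) by (auto simp: reachable_def)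
  have "(hd p, last p) \<in> ?S ^^ (length p - 1)"
    if "p \<noteq> []" "set p \<subseteq> V" "successively (\<lambda>u v. {u, v} \<in> pos s \<union> neg s) p" for p
    using that
  proof (induction p rule: induct_list012)
    case (3 x y zs)
    have "(x, y) \<in> ?S" using 3 by (auto simp: resolved_near_def)
    moreover have "(y, last (y # zs)) \<in> ?S ^^ length zs" using 3 by simp
    ultimately have "(x, last (y # zs)) \<in> ?S ^^ Suc (length zs)" by (rule relpow_Suc_I2)
    then show ?case by simp
  qed simp_all
  from this[of p] p have "(v, w) \<in> ?S ^^ (length p - 1)"
    by (simp add: is_path_def resolved_graph_def)
  from relpow_mono_exponent[OF resolved_near_sub resolved_near_refl assms(2) this p(4)] show ?thesis .
qed

text \<open>A walk contains a path. If prepending \<open>v\<close> to a path revisits \<open>v\<close>, the suffix from \<open>v\<close> on is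
the desired path.\<close>

lemma near_reachable:
  assumes "(v, w) \<in> resolved_near V s ^^ r" "v \<in> V"
  shows "reachable (resolved_graph V s) r v w"
  using assms
proof (induction r arbitrary: v)
  case 0
  then show ?case
    by (auto simp: reachable_def is_path_def resolved_graph_def intro!: exI[of _ "[v]"])
next
  case (Suc r)
  from Suc.prems(1) obtain c where c: "(v, c) \<in> resolved_near V s" "(c, w) \<in> resolved_near V s ^^ r"
    by (rule relpow_Suc_E2)
  then have "c \<in> V" by (auto simp: resolved_near_def)
  from Suc.IH[OF c(2) this] obtain p where
    p: "is_path (resolved_graph V s) p" "hd p = c" "last p = w" "length p - 1 \<le> r"
    by (auto simp: reachable_def)
  have "\<exists>q. is_path (resolved_graph V s) q \<and> hd q = v \<and> last q = w \<and> length q - 1 \<le> Suc r"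
  proof (cases "v \<in> set p")
    case True
    then obtain xs ys where xs: "p = xs @ v # ys" by (auto dest: split_list)
    have "is_path (resolved_graph V s) (v # ys)"
      using p(1) unfolding xs is_path_def by (auto simp: successively_append_iff)
    with p(3,4) show ?thesis unfolding xs by (intro exI[of _ "v # ys"]) simp
  next
    case False
    have "p \<noteq> []" using p(1) by (simp add: is_path_def)
    then have "v \<noteq> c" using False p(2) by auto
    then have "{v, c} \<in> pos s \<union> neg s" using c(1) by (auto simp: resolved_near_def)
    then have "is_path (resolved_graph V s) (v # p)"
      using p(1,2) False Suc.prems(2) by (auto simp: is_path_def resolved_graph_def successively_Cons)
    with p(3,4) \<open>p \<noteq> []\<close> show ?thesis by (intro exI[of _ "v # p"]) auto
  qed
  then show ?case by (simp add: reachable_def)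
qed

lemma reachable_parts_near:
  assumes "v \<in> V"
  shows "reachable_parts V r s v = {A \<in> parts s. \<exists>w\<in>A. (v, w) \<in> resolved_near V s ^^ r}"
  unfolding reachable_parts_def using reachable_near near_reachable assms by metis

definition narrow :: "'a set \<Rightarrow> nat \<Rightarrow> nat \<Rightarrow> 'a cstate \<Rightarrow> bool" where
  "narrow V r k s \<longleftrightarrow> (\<forall>v\<in>V. card (reachable_parts V r s v) \<le> k)"

lemma seq_width_le: "(\<forall>s\<in>set ss. narrow V r k s) \<Longrightarrow> seq_width V r ss \<le> k"
  unfolding seq_width_def narrow_def by (rule Least_le)

lemma seq_width_narrow:
  assumes "finite V" "seq_width V r ss \<le> k" "s \<in> set ss"
  shows "narrow V r k s"
proof -
  let ?b = "\<Sum>s\<in>set ss. \<Sum>v\<in>V. card (reachable_parts V r s v)"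
  have "\<forall>s\<in>set ss. \<forall>v\<in>V. card (reachable_parts V r s v) \<le> ?b"
  proof (intro ballI)
    fix s v assume s: "s \<in> set ss" and v: "v \<in> V"
    have "card (reachable_parts V r s v) \<le> (\<Sum>v\<in>V. card (reachable_parts V r s v))"
      by (rule member_le_sum[OF v _ assms(1)]) simp
    also have "\<dots> \<le> ?b" by (rule member_le_sum[OF s]) simp_all
    finally show "card (reachable_parts V r s v) \<le> ?b" .
  qed
  then have "\<forall>s\<in>set ss. \<forall>v\<in>V. card (reachable_parts V r s v) \<le> seq_width V r ss"
    unfolding seq_width_def by (rule LeastI)
  with assms(2,3) show ?thesis unfolding narrow_def by (meson le_trans)
qed

text \<open>The pairs that the new construction sequence is allowed to have resolved at the time of state \<open>s\<close>.\<close>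

definition close_pairs :: "'a set \<Rightarrow> nat \<Rightarrow> 'a cstate \<Rightarrow> 'a set set" where
  "close_pairs V d s = {{u, v} |u v. u \<in> V \<and> (u, v) \<in> resolved_near V s ^^ d}"

lemma resolved_near_relpow_sym:
  "(u, v) \<in> resolved_near V s ^^ d \<longleftrightarrow> (v, u) \<in> resolved_near V s ^^ d"
  by (auto dest: relpow_sym[OF resolved_near_sym])

lemma close_pairs_iff:
  assumes "u \<in> V" shows "{u, v} \<in> close_pairs V d s \<longleftrightarrow> (u, v) \<in> resolved_near V s ^^ d"
proof
  assume "{u, v} \<in> close_pairs V d s"
  then obtain a b where "{u, v} = {a, b}" "(a, b) \<in> resolved_near V s ^^ d"
    by (auto simp: close_pairs_def)
  then show "(u, v) \<in> resolved_near V s ^^ d"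
    using resolved_near_relpow_sym[of a b] by (auto simp: doubleton_eq_iff)
qed (use assms in \<open>auto simp: close_pairs_def\<close>)

lemma relpow_mono_rel: "R \<subseteq> S \<Longrightarrow> R ^^ n \<subseteq> (S :: 'a rel) ^^ n"
  by (induction n) (auto intro: relcomp_mono)

lemma close_pairs_mono:
  assumes "pos s \<union> neg s \<subseteq> pos s' \<union> neg s'"
  shows "close_pairs V d s \<subseteq> close_pairs V d s'"
  using relpow_mono_rel[OF resolved_near_mono[OF assms], of d V] unfolding close_pairs_def by blast

lemma near_close_pairs:
  assumes x: "pos x \<union> neg x \<subseteq> close_pairs V d s"
  shows "v \<in> V \<Longrightarrow> (v, w) \<in> resolved_near V x ^^ r \<Longrightarrow> (v, w) \<in> resolved_near V s ^^ (r * d)"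
proof (induction r arbitrary: w)
  case (Suc r)
  from Suc.prems(2) obtain c where c: "(v, c) \<in> resolved_near V x ^^ r" "(c, w) \<in> resolved_near V x"
    by (rule relpow_Suc_E)
  have "c \<in> V" using c(2) by (auto simp: resolved_near_def)
  have "(c, w) \<in> resolved_near V s ^^ d"
  proof (cases "c = w")
    case True
    have "(c, c) \<in> resolved_near V s ^^ d"
      using relpow_mono_exponent[OF resolved_near_sub resolved_near_refl \<open>c \<in> V\<close>, where y = c and i = 0 and j = d] by simp
    with True show ?thesis by simp
  next
    case False
    with c(2) x have "{c, w} \<in> close_pairs V d s" by (auto simp: resolved_near_def)
    with close_pairs_iff[OF \<open>c \<in> V\<close>] show ?thesis by simp
  qed
  from relpow_trans[OF Suc.IH[OF Suc.prems(1) c(1)] this] show ?case by (simp add: add.commute)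
qed simp

text \<open>The new states between the times \<open>s\<close> and \<open>s'\<close> have a partition coarser than the types of \<open>s\<close> and
have resolved only close pairs of \<open>s'\<close>. A path of length \<open>r\<close> in their resolved graph stays within distance
\<open>r * d\<close> in that of \<open>s'\<close>. The types of \<open>s\<close> in this ball are determined by local games, which move
at most \<open>level (Suc n) n\<close> further and thus see at most \<open>K\<close> parts.\<close>

lemma bounded_width_of_types:
  "\<exists>B. \<forall>(V :: 'a set) E (s :: 'a cstate) (s' :: 'a cstate) (x :: 'a cstate). finite V \<longrightarrow> consistent V E s \<longrightarrow>
     pos s \<union> neg s \<subseteq> pos s' \<union> neg s' \<longrightarrow>
     (\<forall>v\<in>V. card {A \<in> parts s. \<exists>w\<in>A. (v, w) \<in> resolved_near V s' ^^ (r * d + level (Suc n) n)} \<le> K) \<longrightarrow>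
     refines V (types V E n s) (parts x) \<longrightarrow> pos x \<union> neg x \<subseteq> close_pairs V d s' \<longrightarrow> narrow V r B x"
proof -
  define L where "L = level (Suc n) n"
  obtain B :: nat where B: "\<And>E S P (X :: 'a set).
     finite {A \<in> P. A \<inter> X \<noteq> {}} \<Longrightarrow> card {A \<in> P. A \<inter> X \<noteq> {}} \<le> K \<Longrightarrow> (\<forall>x\<in>X. (x, x) \<in> S) \<Longrightarrow>
     \<exists>c. local_invariant E S P X L 1 B c"
    using bounded_local_types[of 1 K L, OF zero_less_one] by auto
  show ?thesis
  proof (intro exI[of _ B] allI impI)
    fix V :: "'a set" and E and s s' x :: "'a cstate"
    assume V: "finite V" and s: "consistent V E s"
      and res: "pos s \<union> neg s \<subseteq> pos s' \<union> neg s'"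
      and card: "\<forall>v\<in>V. card {A \<in> parts s. \<exists>w\<in>A. (v, w) \<in> resolved_near V s' ^^ (r * d + level (Suc n) n)} \<le> K"
      and ref: "refines V (types V E n s) (parts x)"
      and x: "pos x \<union> neg x \<subseteq> close_pairs V d s'"
    let ?S = "resolved_near V s" and ?S' = "resolved_near V s'"
    have part_x: "partition_on V (parts x)" using ref by (simp add: refines_def)
    have part_s: "partition_on V (parts s)" by (rule consistentD(1)[OF s])
    show "narrow V r B x"
      unfolding narrow_def
    proof
      fix v assume v: "v \<in> V"
      define X where "X = (?S' ^^ (r * d + L)) `` {v}"
      have XV: "X \<subseteq> V" using relpow_range[OF resolved_near_sub _ v] by (auto simp: X_def)
      have meet: "{A \<in> parts s. A \<inter> X \<noteq> {}} = {A \<in> parts s. \<exists>w\<in>A. (v, w) \<in> ?S' ^^ (r * d + L)}"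
        by (auto simp: X_def)
      have fin: "finite {A \<in> parts s. A \<inter> X \<noteq> {}}" using finite_elements[OF V part_s] by simp
      have "card {A \<in> parts s. A \<inter> X \<noteq> {}} \<le> K" using card v unfolding meet L_def by simp
      moreover have "\<forall>x\<in>X. (x, x) \<in> ?S" using XV by (auto simp: resolved_near_def)
      ultimately obtain c where c: "local_invariant E ?S (parts s) X L 1 B c"
        using B[OF fin] by blast
      define f where "f A = (SOME w. w \<in> A \<and> (v, w) \<in> ?S' ^^ (r * d))" for A
      have f: "f A \<in> A \<and> (v, f A) \<in> ?S' ^^ (r * d)" if A: "A \<in> reachable_parts V r x v" for A
      proof -
        obtain w where "w \<in> A" "(v, w) \<in> resolved_near V x ^^ r"
          using A unfolding reachable_parts_near[OF v] by blast
        with near_close_pairs[OF x v] have "w \<in> A \<and> (v, w) \<in> ?S' ^^ (r * d)" by blast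
        then show ?thesis unfolding f_def by (rule someI)
      qed
      have ball: "(?S ^^ i) `` {f A} \<subseteq> X" if A: "A \<in> reachable_parts V r x v" and i: "i \<le> L" for A i
      proof
        fix y assume "y \<in> (?S ^^ i) `` {f A}"
        then have "(f A, y) \<in> ?S' ^^ i" using relpow_mono_rel[OF resolved_near_mono[OF res]] by blast
        from relpow_trans[OF conjunct2[OF f[OF A]] this] have "(v, y) \<in> ?S' ^^ (r * d + i)" .
        from relpow_mono_exponent[OF resolved_near_sub resolved_near_refl v this, where j = "r * d + L"] i
        show "y \<in> X" by (simp add: X_def)
      qed
      have "inj_on (\<lambda>A. c [f A]) (reachable_parts V r x v)"
      proof (rule inj_onI)
        fix A A' assume A: "A \<in> reachable_parts V r x v" and A': "A' \<in> reachable_parts V r x v"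
          and eq: "c [f A] = c [f A']"
        have parts: "A \<in> parts x" "A' \<in> parts x" using A A' by (auto simp: reachable_parts_def)
        then have fV: "f A \<in> V" "f A' \<in> V" using f[OF A] f[OF A'] part_x by (auto simp: partition_on_def)
        have "\<forall>x\<in>set [f A] \<union> set [f A']. \<forall>i\<le>L. (?S ^^ i) `` {x} \<subseteq> X"
          using ball[OF A] ball[OF A'] by simp
        moreover have "length [f A] = 1" "length [f A'] = 1" by simp_all
        ultimately have "local_game E ?S (parts s) L (set (zip [f A] [f A']))"
          using c eq unfolding local_invariant_def by (iprover elim: conjE dest: spec mp)
        then have "local_game E ?S (parts s) (level (Suc n) n) {(f A, f A')}" by (simp add: L_def)
        from homogeneous_partition.local_game_game[OF consistent_homogeneous_partition[OF V s] this fV]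
        have game: "state_game V E s n {(f A, f A')}" .
        obtain T where T: "T \<in> types V E n s" "f A \<in> T"
          using partition_on_part_ex[OF partition_on_types fV(1)] by (rule bexE)
        have "f A' \<in> T" by (rule same_typeI[OF T fV(2) game])
        moreover obtain C where C: "C \<in> parts x" "T \<subseteq> C" using ref T(1) unfolding refines_def by blast
        ultimately have "A = C" "A' = C"
          using partition_on_part_unique[OF part_x] parts f[OF A] f[OF A'] T(2) by auto
        then show "A = A'" by simp
      qed
      moreover have "(\<lambda>A. c [f A]) ` reachable_parts V r x v \<subseteq> {..<B}"
        using c by (auto simp: local_invariant_def)
      ultimately have "card (reachable_parts V r x v) \<le> card {..<B}" by (rule card_inj_on_le) simp
      then show "card (reachable_parts V r x v) \<le> B" by simp
    qed
  qed
qed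

section \<open>Construction sequences of the interpreted graph\<close>

lemma interp_edges_iff:
  "{u, v} \<in> [verts G]\<^bsup>2\<^esup> \<Longrightarrow> {u, v} \<in> edges (interp \<phi> G) \<longleftrightarrow> sat2 G \<phi> u v \<or> sat2 G \<phi> v u"
  by (auto simp: interp_def doubleton_eq_iff)

lemma interp_edges_subset: "edges (interp \<phi> G) \<subseteq> [verts G]\<^bsup>2\<^esup>"
  by (auto simp: interp_def)

text \<open>For vertices that are not close, the types in \<open>G\<close> decide adjacency in \<open>\<phi>(G)\<close>. The position is symmetric
in the two pairs of pebbles, so it settles \<open>\<phi>(a,b)\<close> and \<open>\<phi>(b,a)\<close> at once.\<close>

lemma types_homogeneous:
  assumes fin: "finite (verts G)" and s: "consistent (verts G) (edges G) s"
    and fv: "fv \<phi> \<subseteq> {0, 1}" and q: "q = quantifier_rank \<phi>"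
    and AB: "A \<in> types (verts G) (edges G) (level (q + 2) q) s" "B \<in> types (verts G) (edges G) (level (q + 2) q) s"
    and e: "e \<in> [verts G]\<^bsup>2\<^esup> - close_pairs (verts G) (4 ^ q) s" "e \<in> pairs_between A B"
    and e': "e' \<in> [verts G]\<^bsup>2\<^esup> - close_pairs (verts G) (4 ^ q) s" "e' \<in> pairs_between A B"
  shows "e \<in> edges (interp \<phi> G) \<longleftrightarrow> e' \<in> edges (interp \<phi> G)"
proof -
  let ?V = "verts G" and ?S = "resolved_near (verts G) s"
  obtain a b where ab: "e = {a, b}" "a \<in> A" "b \<in> B" using e(2) by (auto simp: pairs_between_def)
  obtain a' b' where ab': "e' = {a', b'}" "a' \<in> A" "b' \<in> B" using e'(2) by (auto simp: pairs_between_def)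
  note A = same_type[OF AB(1) ab(2) ab'(2)] and B = same_type[OF AB(2) ab(3) ab'(3)]
  have far: "(a, b) \<notin> ?S ^^ (4 ^ q)" "(a', b') \<notin> ?S ^^ (4 ^ q)"
    using e(1) e'(1) close_pairs_iff[OF A(1)] close_pairs_iff[OF A(2)] ab(1) ab'(1) by auto
  from homogeneous_partition.game_far_pair[OF consistent_homogeneous_partition[OF fin s] A(3) B(3) A(1,2) B(1,2) far]
  have game: "game ?V (edges G) ?S (parts s) (quantifier_rank \<phi>) {(a, a'), (b, b')}" by (simp add: q)
  have "sat2 G \<phi> a b \<longleftrightarrow> sat2 G \<phi> a' b'" by (rule game_sat2[OF game fv])
  moreover have "sat2 G \<phi> b a \<longleftrightarrow> sat2 G \<phi> b' a'"
    using game by (intro game_sat2[OF _ fv]) (simp add: insert_commute)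
  ultimately show ?thesis
    using e(1) e'(1) interp_edges_iff[of a b G \<phi>] interp_edges_iff[of a' b' G \<phi>] ab(1) ab'(1) by simp
qed

lemma successively_cpath:
  "ss \<noteq> [] \<Longrightarrow> successively cstep ss \<Longrightarrow> (\<forall>s\<in>set ss. I s) \<Longrightarrow> cpath I (hd ss) (last ss)"
proof (induction ss rule: induct_list012)
  case (2 x)
  then show ?case by (simp add: cpath_refl)
next
  case (3 x y zs)
  then have "cpath I y (last (y # zs))" by simp
  from cpath_Cons[OF _ _ _ this, of x] 3 show ?case by simp
qed simp

lemma cpath_successively:
  assumes "cpath I s s'" "I s"
  shows "\<exists>ss. ss \<noteq> [] \<and> hd ss = s \<and> last ss = s' \<and> successively cstep ss \<and> (\<forall>x\<in>set ss. I x)"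
  using assms unfolding cpath_def
proof (induction rule: converse_rtranclp_induct)
  case base
  then show ?case by (intro exI[of _ "[s']"]) simp
next
  case (step a b)
  then obtain ss where "ss \<noteq> []" "hd ss = b" "last ss = s'" "successively cstep ss" "\<forall>x\<in>set ss. I x"
    by blast
  with step.hyps(1) show ?case
    by (intro exI[of _ "a # ss"]) (simp add: successively_Cons)
qed

lemma init_state_simps [simp]:
  "parts (init_state V) = (\<lambda>v. {v}) ` V" "pos (init_state V) = {}" "neg (init_state V) = {}"
  "unres (init_state V) = [V]\<^bsup>2\<^esup>"
  by (simp_all add: init_state_def)

lemma well_formed_init: "well_formed V (init_state V)"
  by (simp add: well_formed_def partition_on_singletons)

lemma consistent_init:
  assumes "E \<subseteq> [V]\<^bsup>2\<^esup>" shows "consistent V E (init_state V)"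
proof -
  have "e = e'" if "A \<in> (\<lambda>v. {v}) ` V" "B \<in> (\<lambda>v. {v}) ` V" "e \<in> pairs_between A B" "e' \<in> pairs_between A B"
    for A B e e' using that by (auto simp: pairs_between_def)
  then have hom: "\<forall>A\<in>(\<lambda>v. {v}) ` V. \<forall>B\<in>(\<lambda>v. {v}) ` V. \<forall>e\<in>[V]\<^bsup>2\<^esup> \<inter> pairs_between A B.
      \<forall>e'\<in>[V]\<^bsup>2\<^esup> \<inter> pairs_between A B. e \<in> E \<longleftrightarrow> e' \<in> E"
    by (intro ballI) (metis IntD2)
  show ?thesis
    unfolding consistent_def init_state_simps
    by (intro conjI partition_on_singletons assms empty_subsetI hom) simp
qed

lemma cpath_well_formed: "cpath I s s' \<Longrightarrow> well_formed V s \<Longrightarrow> well_formed V s'"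
  unfolding cpath_def by (induction rule: rtranclp_induct) (auto intro: cstep_well_formed)

lemma cpath_consistent:
  assumes "cpath I s z" "well_formed V s" "unres z = {}" "pos z = E"
  shows "consistent V E s"
  using assms(1,2) unfolding cpath_def
proof (induction rule: converse_rtranclp_induct)
  case base
  with assms(3,4) show ?case by (auto simp: well_formed_def consistent_def)
next
  case (step a b)
  then show ?case using cstep_well_formed cstep_consistent_backwards by blast
qed

text \<open>Initially all parts are singletons, so that every vertex is identified by a unary predicate.\<close>

lemma types_init: "types V E n (init_state V) = (\<lambda>v. {v}) ` V"
proof (rule refines_asym[of V])
  let ?T = "types V E n (init_state V)"
  have single: "u = v" if A: "A \<in> ?T" "u \<in> A" "v \<in> A" for A u v
    using partial_isoD(1)[OF game_partial_iso[OF same_type(3)[OF A]], of u v "{u}"] same_type(1)[OF A] by simp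
  show "refines V ?T ((\<lambda>v. {v}) ` V)"
    unfolding refines_def
  proof (intro conjI ballI partition_on_types partition_on_singletons)
    fix A assume A: "A \<in> ?T"
    then obtain u where u: "u \<in> A" using partition_onD3[OF partition_on_types[of V E n "init_state V"]] by fastforce
    have "A \<subseteq> {u}" using single[OF A u] by blast
    moreover have "u \<in> V" by (rule same_type(1)[OF A u u])
    ultimately show "\<exists>B\<in>(\<lambda>v. {v}) ` V. A \<subseteq> B" by blast
  qed
  show "refines V ((\<lambda>v. {v}) ` V) ?T"
    unfolding refines_def
  proof (intro conjI ballI partition_on_types partition_on_singletons)
    fix A assume "A \<in> (\<lambda>v. {v}) ` V"
    then obtain v where v: "v \<in> V" "A = {v}" by blast
    from partition_on_part_ex[OF partition_on_types v(1)] show "\<exists>B\<in>?T. A \<subseteq> B" unfolding v(2) by simp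
  qed
qed

text \<open>The width at radius \<open>r\<close> of the new sequence is controlled by the width of the given one at the larger radius
\<open>R\<close>. The new sequence is built along the given one, keeping the partition equal to the types of the
current state. In the end all pairs are resolved in the given sequence, hence close, and a last
application of \<open>lazy_construction\<close> may resolve all remaining pairs and merge all types.\<close>

lemma interp_width:
  assumes fv: "fv \<phi> \<subseteq> {0, 1}"
  shows "\<exists>R. \<forall>K. \<exists>B. \<forall>G :: 'a graph. fin_graph G \<longrightarrow>
    (\<exists>ss. construction_seq G ss \<and> seq_width (verts G) R ss \<le> K) \<longrightarrow>
    (\<exists>ss. construction_seq (interp \<phi> G) ss \<and> seq_width (verts G) r ss \<le> B)"
proof -
  define q where "q = quantifier_rank \<phi>"
  define d :: nat where "d = 4 ^ q"
  define n where "n = level (q + 2) q"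
  define R where "R = r * d + level (Suc n) n"
  show ?thesis
  proof (rule exI[of _ R], rule allI)
    fix K
    obtain B where B: "\<And>(V :: 'a set) E (s :: 'a cstate) (s' :: 'a cstate) (x :: 'a cstate).
      finite V \<Longrightarrow> consistent V E s \<Longrightarrow> pos s \<union> neg s \<subseteq> pos s' \<union> neg s' \<Longrightarrow>
      \<forall>v\<in>V. card {A \<in> parts s. \<exists>w\<in>A. (v, w) \<in> resolved_near V s' ^^ R} \<le> K \<Longrightarrow>
      refines V (types V E n s) (parts x) \<Longrightarrow> pos x \<union> neg x \<subseteq> close_pairs V d s' \<Longrightarrow> narrow V r B x"
      using bounded_width_of_types[of r d n K] unfolding R_def by blast
    show "\<exists>B. \<forall>G :: 'a graph. fin_graph G \<longrightarrow>
      (\<exists>ss. construction_seq G ss \<and> seq_width (verts G) R ss \<le> K) \<longrightarrow>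
      (\<exists>ss. construction_seq (interp \<phi> G) ss \<and> seq_width (verts G) r ss \<le> B)"
    proof (intro exI[of _ B] allI impI)
      fix G :: "'a graph"
      assume "fin_graph G"
      then have fin: "finite (verts G)" and EG: "edges G \<subseteq> [verts G]\<^bsup>2\<^esup>" by (auto simp: fin_graph_def)
      assume "\<exists>ss. construction_seq G ss \<and> seq_width (verts G) R ss \<le> K"
      then obtain ss where ss: "construction_seq G ss" "seq_width (verts G) R ss \<le> K" by blast
      define V where "V = verts G"
      define E where "E = edges G"
      define E' where "E' = edges (interp \<phi> G)"
      define z where "z = last ss"
      define N where "N = narrow V R K"
      define I where "I = narrow V r B"
      have V: "finite V" using fin by (simp add: V_def)
      have E': "E' \<subseteq> [V]\<^bsup>2\<^esup>" unfolding E'_def V_def by (rule interp_edges_subset)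
      have narrow: "\<forall>s\<in>set ss. N s"
        using seq_width_narrow[OF fin ss(2)] by (simp add: N_def V_def)
      have whole: "cpath N (init_state V) z"
        using successively_cpath[of ss N] ss(1) narrow by (simp add: construction_seq_def z_def V_def)
      have z: "unres z = {}" "pos z = E" "card (parts z) \<le> 1" "N z"
        using ss(1) narrow by (simp_all add: construction_seq_def z_def E_def)
      have consistent: "consistent V E s" if "cpath N (init_state V) s" "cpath N s z" for s
        by (rule cpath_consistent[OF that(2) cpath_well_formed[OF that(1) well_formed_init] z(1,2)])
      have hom: "e \<in> E' \<longleftrightarrow> e' \<in> E'"
        if "consistent V E s" "A \<in> types V E n s" "C \<in> types V E n s"
          "e \<in> [V]\<^bsup>2\<^esup> - close_pairs V d s" "e \<in> pairs_between A C"
          "e' \<in> [V]\<^bsup>2\<^esup> - close_pairs V d s" "e' \<in> pairs_between A C" for s A C e e'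
        using types_homogeneous[OF fin _ fv q_def] that
        unfolding V_def E_def E'_def n_def d_def by metis
      \<comment> \<open>a step changes the partition or the resolved pairs, but not both; so the old parts near a vertex, measured with
        the new resolved pairs, are counted by the width of one of the two states\<close>
      have width: "card {A \<in> parts s. \<exists>w\<in>A. (v, w) \<in> resolved_near V s' ^^ R} \<le> K"
        if "N s" "N s'" "resolved_near V s' = resolved_near V s \<or> parts s' = parts s" "v \<in> V" for s s' v
        using that reachable_parts_near[of v V R s] reachable_parts_near[of v V R s']
        by (auto simp: N_def narrow_def)
      have "\<exists>x. cpath I (init_state V) x \<and> consistent V E' x \<and> parts x = types V E n s \<and>
          pos x \<union> neg x \<subseteq> close_pairs V d s"
        if "cpath N (init_state V) s" "cpath N s z" for s
        using that unfolding cpath_def[of N]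
      proof (induction rule: rtranclp_induct)
        case base
        show ?case
          by (intro exI[of _ "init_state V"] conjI cpath_refl consistent_init E')
            (simp_all add: types_init)
      next
        case (step s s')
        have s: "cpath N (init_state V) s" using step.hyps(1) by (simp add: cpath_def)
        have ss': "cstep s s'" "N s" "N s'" using step.hyps(2) by auto
        have s'z: "cpath N s' z" using step.prems by (simp add: cpath_def)
        have s': "cpath N (init_state V) s'" by (rule cpath_step[OF s ss'])
        have sz: "cpath N s z" by (rule cpath_Cons[OF ss' s'z])
        have cons: "consistent V E s" "consistent V E s'" using consistent s sz s' s'z by blast+
        have mono: "pos s \<union> neg s \<subseteq> pos s' \<union> neg s'" using cstep_resolved_mono[OF ss'(1)] by blast
        have same: "resolved_near V s' = resolved_near V s \<or> parts s' = parts s"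
          using ss'(1) by cases (simp_all add: resolved_near_def)
        obtain x where x: "cpath I (init_state V) x" "consistent V E' x" "parts x = types V E n s"
          "pos x \<union> neg x \<subseteq> close_pairs V d s" using step.IH sz unfolding cpath_def[of N] by blast
        have "\<exists>y. cpath I x y \<and> consistent V E' y \<and> parts y = types V E n s' \<and>
            pos y \<union> neg y \<subseteq> close_pairs V d s' \<and> ([V]\<^bsup>2\<^esup> \<subseteq> close_pairs V d s' \<longrightarrow> unres y = {})"
        proof (rule lazy_construction[OF V x(2)])
          show "refines V (parts x) (types V E n s')"
            unfolding x(3) by (rule refines_types_step[OF ss'(1) cpath_well_formed[OF s well_formed_init]])
          show "pos x \<union> neg x \<subseteq> close_pairs V d s'"
            using x(4) close_pairs_mono[OF mono] by blast
        next
          fix y :: "'a cstate"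
          assume "refines V (parts x) (parts y)" "pos y \<union> neg y \<subseteq> close_pairs V d s'"
          then show "I y"
            unfolding I_def x(3) by (intro B[OF V cons(1) mono]) (use width[OF ss'(2,3) same] in auto)
        qed (rule hom[OF cons(2)])
        then obtain y where "cpath I x y" "consistent V E' y" "parts y = types V E n s'"
          "pos y \<union> neg y \<subseteq> close_pairs V d s'" by blast
        with cpath_trans[OF x(1)] show ?case by blast
      qed
      from this[OF whole cpath_refl] obtain x where
        x: "cpath I (init_state V) x" "consistent V E' x" "parts x = types V E n z"
          "pos x \<union> neg x \<subseteq> close_pairs V d z" by blast
      have cons_z: "consistent V E z" by (rule consistent[OF whole cpath_refl])
      have all_close: "[V]\<^bsup>2\<^esup> \<subseteq> close_pairs V d z"
      proof
        fix e assume "e \<in> [V]\<^bsup>2\<^esup>"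
        then obtain u v where uv: "e = {u, v}" "u \<in> V" "v \<in> V" by (rule nsets2_E) auto
        moreover have "e \<in> pos z \<union> neg z" using consistentD(5)[OF cons_z] z(1) \<open>e \<in> [V]\<^bsup>2\<^esup>\<close> by auto
        ultimately have "(u, v) \<in> resolved_near V z ^^ 1" by (auto simp: resolved_near_def)
        from relpow_mono_exponent[OF resolved_near_sub resolved_near_refl uv(2) this, where j = d]
        show "e \<in> close_pairs V d z" unfolding uv(1) close_pairs_iff[OF uv(2)] by (simp add: d_def)
      qed
      \<comment> \<open>for the graph without vertices the final partition is empty\<close>
      define P where "P = {V} - {{}}"
      have P: "partition_on V P" by (auto simp: P_def partition_on_def disjoint_def)
      have I_last: "I y" if "refines V (parts x) (parts y)" "pos y \<union> neg y \<subseteq> [V]\<^bsup>2\<^esup>" for y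
        unfolding I_def
      proof (rule B[OF V cons_z order_refl])
        show "\<forall>v\<in>V. card {A \<in> parts z. \<exists>w\<in>A. (v, w) \<in> resolved_near V z ^^ R} \<le> K"
          using width[OF z(4) z(4)] by simp
        show "refines V (types V E n z) (parts y)" using that(1) by (simp add: x(3))
        show "pos y \<union> neg y \<subseteq> close_pairs V d z" using that(2) all_close by blast
      qed
      have "\<exists>y. cpath I x y \<and> consistent V E' y \<and> parts y = P \<and>
          pos y \<union> neg y \<subseteq> [V]\<^bsup>2\<^esup> \<and> ([V]\<^bsup>2\<^esup> \<subseteq> [V]\<^bsup>2\<^esup> \<longrightarrow> unres y = {})"
      proof (rule lazy_construction[OF V x(2)])
        have part_x: "partition_on V (parts x)" by (rule consistentD(1)[OF x(2)])
        show "refines V (parts x) P"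
          unfolding refines_def
        proof (intro conjI ballI part_x P)
          fix A assume A: "A \<in> parts x"
          with part_x have "A \<noteq> {}" "A \<subseteq> V" by (auto simp: partition_on_def)
          then show "\<exists>B\<in>P. A \<subseteq> B" by (auto simp: P_def)
        qed
        show "pos x \<union> neg x \<subseteq> [V]\<^bsup>2\<^esup>" using consistentD(2-4)[OF x(2)] by blast
      qed (use I_last in auto)
      then obtain y where y: "cpath I x y" "consistent V E' y" "parts y = P" "unres y = {}" by blast
      have "I (init_state V)"
        unfolding I_def
      proof (rule B[OF V _ order_refl])
        have init: "N (init_state V)"
          using narrow ss(1) hd_in_set[of ss] by (auto simp: construction_seq_def V_def)
        show "consistent V E (init_state V)" by (rule consistent[OF cpath_refl whole])
        show "\<forall>v\<in>V. card {A \<in> parts (init_state V). \<exists>w\<in>A. (v, w) \<in> resolved_near V (init_state V) ^^ R} \<le> K"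
          using width[OF init init] by simp
        show "refines V (types V E n (init_state V)) (parts (init_state V))"
          by (simp add: types_init refines_refl partition_on_singletons)
      qed simp
      from cpath_successively[OF cpath_trans[OF x(1) y(1)] this] obtain ts where
        ts: "ts \<noteq> []" "hd ts = init_state V" "last ts = y" "successively cstep ts" "\<forall>s\<in>set ts. I s" by blast
      have "pos y = E'" using consistentD(2-5)[OF y(2)] y(4) by blast
      moreover have "card P \<le> 1" by (simp add: P_def card_Diff_singleton_if)
      ultimately have "construction_seq (interp \<phi> G) ts"
        using ts y by (simp add: construction_seq_def E'_def V_def interp_def)
      moreover have "seq_width (verts G) r ts \<le> B"
        using ts(5) by (intro seq_width_le) (simp add: I_def V_def)
      ultimately show "\<exists>ss. construction_seq (interp \<phi> G) ss \<and> seq_width (verts G) r ss \<le> B" by blast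
    qed
  qed
qed

section \<open>Boundedness of merge-width\<close>

text \<open>The infimum that defines merge-width ranges over natural numbers, so if finite it is attained.\<close>

lemma bounded_merge_width_iff:
  "bounded_merge_width C \<longleftrightarrow>
    (\<forall>r. \<exists>k. \<forall>G\<in>C. \<exists>ss. construction_seq G ss \<and> seq_width (verts G) r ss \<le> k)"
proof
  assume C: "bounded_merge_width C"
  show "\<forall>r. \<exists>k. \<forall>G\<in>C. \<exists>ss. construction_seq G ss \<and> seq_width (verts G) r ss \<le> k"
  proof
    fix r
    from C have "(SUP G\<in>C. merge_width r G) < \<infinity>" by (simp add: bounded_merge_width_def)
    then obtain k where k: "(SUP G\<in>C. merge_width r G) = enat k" by (cases "SUP G\<in>C. merge_width r G") auto
    have "\<exists>ss. construction_seq G ss \<and> seq_width (verts G) r ss \<le> k" if "G \<in> C" for G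
    proof -
      have "merge_width r G \<le> enat k" unfolding k[symmetric] using that by (rule SUP_upper)
      also have "\<dots> < enat (Suc k)" by simp
      finally obtain ss where "construction_seq G ss" "enat (seq_width (verts G) r ss) < enat (Suc k)"
        unfolding merge_width_def INF_less_iff by blast
      then show ?thesis by (intro exI[of _ ss]) simp
    qed
    then show "\<exists>k. \<forall>G\<in>C. \<exists>ss. construction_seq G ss \<and> seq_width (verts G) r ss \<le> k" by blast
  qed
next
  assume *: "\<forall>r. \<exists>k. \<forall>G\<in>C. \<exists>ss. construction_seq G ss \<and> seq_width (verts G) r ss \<le> k"
  show "bounded_merge_width C"
    unfolding bounded_merge_width_def
  proof
    fix r
    obtain k where k: "\<forall>G\<in>C. \<exists>ss. construction_seq G ss \<and> seq_width (verts G) r ss \<le> k" using * by blast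
    have "merge_width r G \<le> enat k" if "G \<in> C" for G
    proof -
      obtain ss where "construction_seq G ss" "seq_width (verts G) r ss \<le> k" using k \<open>G \<in> C\<close> by blast
      then show ?thesis unfolding merge_width_def by (intro INF_lower2[of ss]) simp_all
    qed
    then have "(SUP G\<in>C. merge_width r G) \<le> enat k" by (rule SUP_least)
    also have "\<dots> < \<infinity>" by simp
    finally show "(SUP G\<in>C. merge_width r G) < \<infinity>" .
  qed
qed

theorem theorem1p12:
  fixes \<phi> :: fo and C :: "'a graph set"
  assumes "fv \<phi> \<subseteq> {0, 1}"
    and "\<And>G. G \<in> C \<Longrightarrow> fin_graph G"
    and "bounded_merge_width C"
  shows "bounded_merge_width (interp \<phi> ` C)"
proof -
  have bounded: "\<forall>r. \<exists>k. \<forall>G\<in>C. \<exists>ss. construction_seq G ss \<and> seq_width (verts G) r ss \<le> k"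
    using assms(3) bounded_merge_width_iff[of C] by simp
  have "\<exists>B. \<forall>G\<in>interp \<phi> ` C. \<exists>ss. construction_seq G ss \<and> seq_width (verts G) r ss \<le> B" for r
  proof -
    obtain R where R: "\<forall>K. \<exists>B. \<forall>G :: 'a graph. fin_graph G \<longrightarrow>
        (\<exists>ss. construction_seq G ss \<and> seq_width (verts G) R ss \<le> K) \<longrightarrow>
        (\<exists>ss. construction_seq (interp \<phi> G) ss \<and> seq_width (verts G) r ss \<le> B)"
      using interp_width[OF assms(1), of r] by (rule exE)
    obtain K where K: "\<forall>G\<in>C. \<exists>ss. construction_seq G ss \<and> seq_width (verts G) R ss \<le> K"
      using bounded by blast
    obtain B where "\<forall>G :: 'a graph. fin_graph G \<longrightarrow>
        (\<exists>ss. construction_seq G ss \<and> seq_width (verts G) R ss \<le> K) \<longrightarrow>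
        (\<exists>ss. construction_seq (interp \<phi> G) ss \<and> seq_width (verts G) r ss \<le> B)"
      using R by blast
    with K assms(2) have "\<exists>ss. construction_seq (interp \<phi> G) ss \<and> seq_width (verts G) r ss \<le> B"
      if "G \<in> C" for G using that by blast
    moreover have "verts (interp \<phi> G) = verts G" for G :: "'a graph" by (simp add: interp_def)
    ultimately show ?thesis by (intro exI[of _ B]) simp
  qed
  then show ?thesis
    unfolding bounded_merge_width_iff by (intro allI)
qed

end
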